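(* Let $\mathbf{U}=\bigvee_{p\in\mathbb{P}}\mathbf{Ab}(p)*\mathbf{Ab}(p-1)$. Then $\mathbf{Ab}\subset\mathbf{U}\subset\mathbf{Su}\cap\mathbf{M}$, where both inclusions are proper.
   Context: A pseudovariety is a class of finite groups closed under taking subgroups, homomorphic images and finitary direct products; $\bigvee$ denotes join (smallest pseudovariety containing all the given ones). $\mathbb{P}$ is the set of all primes. $\mathbf{Ab}$ is the pseudovariety of finite abelian groups and $\mathbf{Ab}(n)$ the pseudovariety of finite abelian groups of exponent dividing $n$. For pseudovarieties $\mathbf{V},\mathbf{W}$, $\mathbf{V}*\mathbf{W}$ is the pseudovariety of all finite groups $G$ having a normal subgroup $N\in\mathbf{V}$ with $G/N\in\mathbf{W}$. $\mathbf{Su}$ is the pseudovariety of finite supersolvable groups (all chief factors cyclic), and $\mathbf{M}$ is the pseudovariety of finite metabelian groups (those with abelian derived subgroup). *)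

theory Defs
  imports "HOL-Algebra.Algebra" "HOL-Computational_Algebra.Primes"
begin

text \<open>
  A class of finite groups is represented by a set of groups with underlying set contained in
  \<open>nat\<close>. Every finite group is isomorphic to such a group, so nothing is lost as long as the
  classes are closed under isomorphism, which pseudovarieties are. Groups on other types (quotients,
  direct products) belong to a class through an isomorphic copy on \<open>nat\<close>.
\<close>

definition in_class :: "('a, 'b) monoid_scheme \<Rightarrow> nat monoid set \<Rightarrow> bool" where
  "in_class G V \<longleftrightarrow> group G \<and> (\<exists>H\<in>V. G \<cong> H)"

text \<open>
  Closure under finitary direct products includes the empty product, so a pseudovariety
  contains the trivial groups. Closure under homomorphic images yields closure under isomorphism.
\<close>

definition pseudovariety :: "nat monoid set \<Rightarrow> bool" where
  "pseudovariety V \<longleftrightarrow>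
     (\<forall>G\<in>V. group G \<and> finite (carrier G)) \<and>
     (\<forall>G\<in>V. \<forall>H. subgroup H G \<longrightarrow> G\<lparr>carrier := H\<rparr> \<in> V) \<and>
     (\<forall>G\<in>V. \<forall>(K :: nat monoid) h.
        group K \<and> h \<in> hom G K \<and> h ` carrier G = carrier K \<longrightarrow> K \<in> V) \<and>
     (\<forall>(I :: nat set) (F :: nat \<Rightarrow> nat monoid).
        finite I \<and> (\<forall>i\<in>I. F i \<in> V) \<longrightarrow> in_class (product_group I F) V)"

definition pv_join :: "nat monoid set set \<Rightarrow> nat monoid set" where
  "pv_join \<V> = \<Inter>{W. pseudovariety W \<and> (\<forall>V\<in>\<V>. V \<subseteq> W)}"

definition pv_prod :: "nat monoid set \<Rightarrow> nat monoid set \<Rightarrow> nat monoid set"  (infixr \<open>\<star>\<close> 70) where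
  "V \<star> W = {G. group G \<and> finite (carrier G) \<and>
     (\<exists>N. N \<lhd> G \<and> G\<lparr>carrier := N\<rparr> \<in> V \<and> in_class (G Mod N) W)}"

definition group_exponent :: "('a, 'b) monoid_scheme \<Rightarrow> nat" where
  "group_exponent G = Lcm (group.ord G ` carrier G)"

definition Ab :: "nat monoid set" where
  "Ab = {G. comm_group G \<and> finite (carrier G)}"

definition Ab_exp :: "nat \<Rightarrow> nat monoid set" where
  "Ab_exp n = {G \<in> Ab. group_exponent G dvd n}"

text \<open>
  \<open>H / K\<close> is a chief factor of \<open>G\<close>: both are normal in \<open>G\<close>, and \<open>H / K\<close> is a minimal
  nontrivial normal subgroup of \<open>G / K\<close>.
\<close>

definition chief_factor :: "('a, 'b) monoid_scheme \<Rightarrow> 'a set \<Rightarrow> 'a set \<Rightarrow> bool" where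
  "chief_factor G H K \<longleftrightarrow> H \<lhd> G \<and> K \<lhd> G \<and> K \<subset> H \<and>
     (\<forall>L. L \<lhd> G \<and> K \<subseteq> L \<and> L \<subseteq> H \<longrightarrow> L = K \<or> L = H)"

definition supersolvable :: "('a, 'b) monoid_scheme \<Rightarrow> bool" where
  "supersolvable G \<longleftrightarrow> group G \<and>
     (\<forall>H K. chief_factor G H K \<longrightarrow> cyclic_group (G\<lparr>carrier := H\<rparr> Mod K))"

definition metabelian :: "('a, 'b) monoid_scheme \<Rightarrow> bool" where
  "metabelian G \<longleftrightarrow> group G \<and> comm_group (G\<lparr>carrier := derived G (carrier G)\<rparr>)"

definition Su :: "nat monoid set" where
  "Su = {G. finite (carrier G) \<and> supersolvable G}"

definition Metab :: "nat monoid set" where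
  "Metab = {G. finite (carrier G) \<and> metabelian G}"

end

theory Submission
  imports Defs "HOL-Number_Theory.Pocklington"
begin

text \<open>
  Write \<open>G'\<close> for the derived subgroup of \<open>G\<close>, and call the classes \<open>Ab_exp p \<star> Ab_exp (p - 1)\<close>
  the generators of the join \<open>U\<close>.

  \<^item> \<open>Ab \<subseteq> U\<close>: for every prime power \<open>q ^ k\<close> there is a prime \<open>p\<close> with \<open>q ^ k dvd p - 1\<close>
  (\<open>exists_prime_cong_one_mod_prime_power\<close>), so an abelian group of exponent \<open>q ^ k\<close> lies in the
  generator for \<open>p\<close>, with trivial normal subgroup. Every finite abelian group is an image of a
  product of such groups (\<open>Ab_subset_pseudovariety\<close>). The inclusion is proper because the
  generator for \<open>p = 3\<close> contains the nonabelian group of order six.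

  \<^item> \<open>U \<subseteq> Su \<inter> Metab\<close>: in a member of the generator for \<open>p\<close>, the elements \<open>g ^ (p - 1)\<close> and
  the group \<open>G'\<close> lie in a common abelian normal subgroup of exponent \<open>p\<close>. So \<open>G'\<close> is a vector
  space over \<open>GF(p)\<close> on which \<open>G\<close> acts by commuting operators \<open>T\<close> with \<open>T ^ (p - 1) = 1\<close>. Put in
  a form that allows several primes at once, this defines a pseudovariety
  (\<open>pseudovariety_odd_diagonalizable\<close>) that contains all the generators. Since \<open>X ^ (p - 1) - 1\<close>
  splits into distinct linear factors over \<open>GF(p)\<close>, commuting operators of this kind have common
  eigenvectors (\<open>exists_common_eigenvector\<close>). In a chief factor a common eigenvector spans a
  normal subgroup, so the chief factor is cyclic (\<open>supersolvable_if_diagonalizable_derived\<close>).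

  \<^item> The second inclusion is proper: the generators for odd \<open>p\<close> have \<open>G'\<close> of exponent \<open>p\<close>, and
  the generator for \<open>p = 2\<close> consists of abelian groups. So the pseudovariety can be restricted to odd primes, and
  \<open>G'\<close> has odd order for every \<open>G\<close> in \<open>U\<close>. The dihedral group of order eight is supersolvable and
  metabelian, but its derived subgroup has order two.
\<close>

section \<open>Primes congruent to one modulo a prime power\<close>

text \<open>
  An elementary case of Dirichlet's theorem. For \<open>k > 0\<close> and \<open>b = q ^ (q ^ (k - 1))\<close>, take any prime divisor
  \<open>p\<close> of \<open>1 + b + \<dots> + b ^ (q - 1)\<close>. Then \<open>b ^ q = 1\<close> modulo \<open>p\<close>, whereas \<open>b = 1\<close>
  would make the sum congruent to \<open>q\<close>, which is coprime to \<open>p\<close>. Hence \<open>q\<close> has order exactly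
  \<open>q ^ k\<close> modulo \<open>p\<close>, and that order divides \<open>p - 1\<close>.
\<close>

lemma exists_prime_cong_one_mod_prime_power:
  fixes q k :: nat
  assumes q: "Factorial_Ring.prime q"
  obtains p :: nat where "Factorial_Ring.prime p" "q ^ k dvd p - 1"
proof (cases k)
  case 0
  then show ?thesis using that[of 2] by simp
next
  case (Suc j)
  have q2: "q \<ge> 2" using q prime_ge_2_nat by blast
  define b where "b = q ^ (q ^ j)"
  have b: "b \<ge> 2"
    using power_increasing[of 1 "q ^ j" q] q2 unfolding b_def by simp
  define N where "N = (\<Sum>i<q. b ^ i)"
  have tele: "(b - 1) * N = b ^ q - 1"
  proof -
    have "(int b - 1) * int N = int b ^ q - 1"
      unfolding N_def by (simp add: power_diff_1_eq)
    then have "int ((b - 1) * N) = int (b ^ q - 1)" using b by (simp add: of_nat_diff)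
    then show ?thesis by (simp only: of_nat_eq_iff)
  qed
  have "N \<noteq> 1"
  proof
    assume "N = 1"
    then have "b ^ q = b" using tele b by simp
    moreover have "b ^ 1 < b ^ q" using b q2 by (intro power_strict_increasing) auto
    ultimately show False by simp
  qed
  then obtain p where p: "Factorial_Ring.prime p" "p dvd N" using prime_factor_nat by blast
  have bq: "[b ^ q = 1] (mod p)"
  proof -
    have "p dvd b ^ q - 1" using p(2) tele by (metis dvd_mult)
    then obtain c where "b ^ q - 1 = p * c" by (rule dvdE)
    moreover have "b ^ q \<ge> 1" using b by simp
    ultimately have "b ^ q = 1 + p * c" by linarith
    then show ?thesis by (simp only: cong_def mod_mult_self2)
  qed
  have cop: "coprime p q"
  proof (rule ccontr)
    assume "\<not> coprime p q"
    then have "p = q" using p(1) q primes_coprime by blast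
    then have "p dvd b" unfolding b_def using q2 by simp
    then have "[b = 0] (mod p)" by (simp add: cong_0_iff)
    then have "[b ^ q = 0] (mod p)" using cong_pow[of b 0 p q] q2 by (simp add: zero_power)
    then have "[1 = 0] (mod p)" using bq cong_trans cong_sym by blast
    then show False using p(1) by (simp add: cong_0_iff)
  qed
  have b1: "\<not> [b = 1] (mod p)"
  proof
    assume *: "[b = 1] (mod p)"
    have "[N = (\<Sum>i<q. 1)] (mod p)" unfolding N_def
      using cong_pow[OF *] by (intro cong_sum) simp
    then have "p dvd q" using p(2) by (metis cong_dvd_iff card_lessThan sum_constant mult.right_neutral of_nat_id)
    then show False using cop p(1) by (metis coprime_absorb_left not_prime_unit)
  qed
  have "Pocklington.ord p q dvd q ^ k"
    using bq unfolding b_def Suc by (simp add: ord_divides' power_mult[symmetric] mult.commute)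
  moreover have "\<not> Pocklington.ord p q dvd q ^ j"
    using b1 unfolding b_def by (simp add: ord_divides')
  ultimately have "Pocklington.ord p q = q ^ k"
    using q unfolding Suc
    by (metis divides_primepow_nat le_Suc_eq le_imp_power_dvd)
  moreover have "Pocklington.ord p q dvd p - 1"
    using order_divides_totient[of p q] cop p(1) by (simp add: totient_prime)
  ultimately show ?thesis using that p(1) by metis
qed

section \<open>Commuting diagonalizable operators over a prime field\<close>

text \<open>
  Orthogonality of the powers of a primitive root: for \<open>0 < i < p - 1\<close> the geometric sum is
  annihilated by \<open>a ^ i - 1\<close>, which is a unit modulo \<open>p\<close>.
\<close>

lemma primitive_root_orthogonality:
  assumes p: "Factorial_Ring.prime (p::nat)"
  obtains a :: nat where "[a ^ (p - 1) = 1] (mod p)"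
    "\<And>i. i < p - 1 \<Longrightarrow> [(\<Sum>j<p - 1. a ^ (i * j)) = (if i = 0 then p - 1 else 0)] (mod p)"
proof -
  obtain a where a: "Pocklington.ord p a = p - 1"
    using residue_prime_has_primroot[OF p] by blast
  have geo: "[(\<Sum>j<p - 1. a ^ (i * j)) = (if i = 0 then p - 1 else 0)] (mod p)" if i: "i < p - 1" for i
  proof (cases "i = 0")
    case False
    have "\<not> Pocklington.ord p a dvd i" using a i False by (auto dest: dvd_imp_le)
    then have n1: "\<not> [a ^ i = 1] (mod p)" by (simp add: ord_divides')
    have "(int (a ^ i) - 1) * (\<Sum>j<p - 1. int (a ^ i) ^ j) = int (a ^ i) ^ (p - 1) - 1"
      by (simp add: power_diff_1_eq)
    moreover have "[(a ^ i) ^ (p - 1) = 1] (mod p)"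
      by (simp add: ord_divides' a flip: power_mult)
    then have "int p dvd int (a ^ i) ^ (p - 1) - 1"
      by (metis cong_iff_dvd_diff cong_int_iff of_nat_1 of_nat_power)
    ultimately have "int p dvd (int (a ^ i) - 1) * (\<Sum>j<p - 1. int (a ^ i) ^ j)" by (simp only:)
    moreover have "Factorial_Ring.prime (int p)" using p by simp
    ultimately have "int p dvd int (a ^ i) - 1 \<or> int p dvd (\<Sum>j<p - 1. int (a ^ i) ^ j)"
      by (rule prime_dvd_multD[rotated])
    moreover have "\<not> int p dvd int (a ^ i) - 1"
      using n1 by (metis cong_iff_dvd_diff cong_int_iff of_nat_1)
    ultimately have "int p dvd int (\<Sum>j<p - 1. a ^ (i * j))"
      by (simp add: power_mult)
    then show ?thesis using False by (simp add: cong_0_iff del: of_nat_sum)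
  qed simp
  have "[a ^ (p - 1) = 1] (mod p)" by (simp add: ord_divides' a)
  then show ?thesis using geo that by blast
qed

context comm_group begin

lemma pow_cong_mod_exponent:
  assumes "x \<in> carrier G" "x [^] p = \<one>" "[m = n] (mod (p::nat))"
  shows "x [^] m = x [^] n"
proof -
  have "x [^] (int m) = x [^] (int n)"
    using assms by (subst int_pow_eq)
      (auto simp: pow_eq_id cong_iff_dvd_diff cong_int_iff[symmetric] intro: dvd_trans
        simp: dvd_diff_commute)
  then show ?thesis by (simp add: int_pow_int)
qed

lemma finprod_nat_pow:
  assumes "f \<in> A \<rightarrow> carrier G"
  shows "finprod G f A [^] (n::nat) = finprod G (\<lambda>i. f i [^] n) A"
  using assms
proof (induction A rule: infinite_finite_induct)
  case (insert x A)
  then have "(\<lambda>i. f i [^] n) \<in> A \<rightarrow> carrier G" by auto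
  then show ?case using insert by (simp add: nat_pow_distrib)
qed auto

lemma finprod_pow_sum:
  assumes "x \<in> carrier G" "finite A"
  shows "finprod G (\<lambda>i. x [^] (f i :: nat)) A = x [^] (\<Sum>i\<in>A. f i)"
  using assms(2,1) by (induction A) (auto simp: nat_pow_mult)

lemma finprod_swap:
  assumes "finite A" "finite B" "\<And>i j. i \<in> A \<Longrightarrow> j \<in> B \<Longrightarrow> f i j \<in> carrier G"
  shows "finprod G (\<lambda>i. finprod G (f i) B) A = finprod G (\<lambda>j. finprod G (\<lambda>i. f i j) A) B"
  using assms
proof (induction A rule: finite_induct)
  case (insert a A)
  have "finprod G (\<lambda>i. finprod G (f i) B) (insert a A)
     = finprod G (f a) B \<otimes> finprod G (\<lambda>j. finprod G (\<lambda>i. f i j) A) B"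
    using insert by (subst finprod_insert) auto
  also have "\<dots> = finprod G (\<lambda>j. f a j \<otimes> finprod G (\<lambda>i. f i j) A) B"
    using insert by (subst finprod_multf) auto
  also have "\<dots> = finprod G (\<lambda>j. finprod G (\<lambda>i. f i j) (insert a A)) B"
    using insert by (intro finprod_cong) (auto simp: Pi_iff simp_implies_def)
  finally show ?case .
qed auto

text \<open>
  \<open>G\<close> is a vector space over \<open>GF(p)\<close> in multiplicative notation, and \<open>T\<close> is annihilated by
  \<open>X ^ (p - 1) - 1\<close>, which splits over \<open>GF(p)\<close> into distinct linear factors. The projections of
  \<open>x\<close> onto the eigenspaces are, up to a scalar, the discrete Fourier coefficients \<open>y j\<close> below,
  where \<open>a\<close> is a primitive root. By orthogonality they combine to \<open>x ^ (p - 1)\<close>, the inverse of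
  \<open>x\<close>, so they cannot all lie in a subgroup that avoids \<open>x\<close>.
\<close>

lemma exists_eigenvector_outside_subgroup:
  assumes p: "Factorial_Ring.prime (p::nat)" and exp: "\<And>x. x \<in> carrier G \<Longrightarrow> x [^] p = \<one>"
    and T: "T \<in> hom G G" and Tp: "\<And>x. x \<in> carrier G \<Longrightarrow> (T ^^ (p - 1)) x = x"
    and K: "subgroup K G" and x: "x \<in> carrier G" "x \<notin> K"
  obtains y m where "y \<in> carrier G" "y \<notin> K" "T y = y [^] (m::nat)"
proof -
  interpret T: group_hom G G T
    using T by unfold_locales
  have p2: "p \<ge> 2" using p prime_ge_2_nat by blast
  obtain a where a: "[a ^ (p - 1) = 1] (mod p)"
    and geo: "\<And>i. i < p - 1 \<Longrightarrow> [(\<Sum>j<p - 1. a ^ (i * j)) = (if i = 0 then p - 1 else 0)] (mod p)"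
    using primitive_root_orthogonality[OF p] by blast
  have a_pow: "[a ^ ((p - 1) * j) = 1] (mod p)" for j
    using cong_pow[OF a, of j] by (simp add: power_mult)
  have Ti: "(T ^^ i) z \<in> carrier G" if "z \<in> carrier G" for i z
    using that by (induction i) auto
  define t where "t i = (T ^^ i) x" for i
  have t: "t i \<in> carrier G" for i unfolding t_def using Ti x by blast
  define y where "y j = finprod G (\<lambda>i. t i [^] (a ^ (i * j))) {..<p - 1}" for j :: nat
  have yc: "y j \<in> carrier G" for j unfolding y_def using t by auto
  have prod: "finprod G y {..<p - 1} = x [^] (p - 1)"
  proof -
    have "finprod G y {..<p - 1} = finprod G (\<lambda>i. finprod G (\<lambda>j. t i [^] (a ^ (i * j))) {..<p - 1}) {..<p - 1}"
      unfolding y_def using t by (subst finprod_swap) auto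
    also have "\<dots> = finprod G (\<lambda>i. if 0 = i then x [^] (p - 1) else \<one>) {..<p - 1}"
    proof (rule finprod_cong')
      fix i assume "i \<in> {..<p - 1}"
      then have "t i [^] (\<Sum>j<p - 1. a ^ (i * j)) = t i [^] (if i = 0 then p - 1 else 0)"
        using geo exp t by (intro pow_cong_mod_exponent[where p = p]) auto
      then show "finprod G (\<lambda>j. t i [^] (a ^ (i * j))) {..<p - 1} = (if 0 = i then x [^] (p - 1) else \<one>)"
        using t by (auto simp: finprod_pow_sum t_def)
    qed (use x in auto)
    also have "\<dots> = x [^] (p - 1)"
      using p2 x by (subst finprod_singleton) auto
    finally show ?thesis .
  qed
  have "\<exists>j<p - 1. y j \<notin> K"
  proof (rule ccontr)
    assume "\<not> ?thesis"
    then have "\<forall>j<p - 1. y j \<in> K" by blast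
    then have "finprod G y {..<p - 1} \<in> K"
    proof -
      have "finprod G y {..<n} \<in> K" if "\<And>j. j < n \<Longrightarrow> y j \<in> K" for n
        using that
      proof (induction n)
        case 0
        show ?case using subgroup.one_closed[OF K] by simp
      next
        case (Suc n)
        then show ?case using yc by (simp add: lessThan_Suc subgroup.m_closed[OF K])
      qed
      then show ?thesis using \<open>\<forall>j<p - 1. y j \<in> K\<close> by blast
    qed
    then have "x [^] (p - 1) \<in> K" using prod by simp
    moreover have "x [^] (p - 1) \<otimes> x = \<one>"
      using exp[OF x(1)] p2 nat_pow_Suc[of x "p - 1"] by (simp del: nat_pow_Suc add: Suc_diff_le flip: nat_pow_Suc)
    then have "x = inv (x [^] (p - 1))"
      using x by (metis inv_equality inv_inv nat_pow_closed)
    ultimately show False using x(2) subgroup.m_inv_closed[OF K] by metis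
  qed
  then obtain j where j: "y j \<notin> K" by blast
  \<comment> \<open>The inverse of \<open>a ^ j\<close> modulo \<open>p\<close>, by Fermat.\<close>
  define m where "m = (a ^ j) ^ (p - 2)"
  have Ty: "T (y j) = finprod G (\<lambda>i. t (Suc i) [^] (a ^ (i * j))) {..<p - 1}"
  proof -
    have hf: "T (finprod G f {..<n}) = finprod G (\<lambda>i. T (f i)) {..<n}" if "\<And>i. f i \<in> carrier G" for f and n :: nat
      using that by (induction n) (auto simp: lessThan_Suc Pi_iff)
    show ?thesis unfolding y_def using t by (subst hf) (auto simp: T.hom_nat_pow t_def)
  qed
  \<comment> \<open>Applying \<open>T\<close> shifts the index \<open>i\<close> cyclically, so \<open>y j\<close> has eigenvalue \<open>a ^ (- j)\<close>.\<close>
  have shift: "T (y j) [^] (a ^ j) = y j"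
  proof -
    let ?f = "\<lambda>i. t i [^] (a ^ (i * j))"
    have fe: "?f (p - 1) = ?f 0"
    proof -
      have "t (p - 1) [^] (a ^ ((p - 1) * j)) = t (p - 1) [^] (1::nat)"
        by (intro pow_cong_mod_exponent[where p = p]) (use exp t a_pow in auto)
      then show ?thesis using Tp[OF x(1)] x by (simp add: t_def)
    qed
    have "T (y j) [^] (a ^ j) = finprod G (\<lambda>i. ?f (Suc i)) {..<p - 1}"
      unfolding Ty using t by (subst finprod_nat_pow) (auto simp: nat_pow_pow power_add mult.commute)
    also have "\<dots> = finprod G ?f {..<p - 1}"
    proof -
      define n where "n = p - 2"
      have n: "p - 1 = Suc n" using p2 unfolding n_def by linarith
      have "finprod G (\<lambda>i. ?f (Suc i)) {..<Suc n} = ?f (Suc n) \<otimes> finprod G (\<lambda>i. ?f (Suc i)) {..<n}"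
        using t by (simp add: lessThan_Suc Pi_iff)
      also have "\<dots> = ?f 0 \<otimes> finprod G (\<lambda>i. ?f (Suc i)) {..<n}" using fe n by simp
      also have "\<dots> = finprod G ?f {..<Suc n}"
      proof -
        have "finprod G ?f {..<Suc n} = finprod G ?f (insert 0 (Suc ` {..<n}))"
          by (simp add: lessThan_Suc_eq_insert_0)
        also have "\<dots> = ?f 0 \<otimes> finprod G ?f (Suc ` {..<n})"
          using t by (subst finprod_insert) auto
        also have "finprod G ?f (Suc ` {..<n}) = finprod G (\<lambda>i. ?f (Suc i)) {..<n}"
          using t by (subst finprod_reindex) auto
        finally show ?thesis by simp
      qed
      finally show ?thesis using n by simp
    qed
    finally show ?thesis by (simp add: y_def)
  qed
  have "T (y j) = T (y j) [^] (a ^ j * m)"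
  proof -
    have "a ^ j * m = a ^ ((p - 1) * j)"
    proof -
      have "a ^ j * m = (a ^ j) ^ Suc (p - 2)" by (simp add: m_def)
      also have "Suc (p - 2) = p - 1" using p2 by linarith
      finally show ?thesis by (simp add: power_mult[symmetric] mult.commute)
    qed
    moreover note a_pow[of j]
    ultimately have "T (y j) [^] (a ^ j * m) = T (y j) [^] (1::nat)"
      using exp yc by (intro pow_cong_mod_exponent[where p = p]) auto
    then show ?thesis using yc by simp
  qed
  also have "\<dots> = y j [^] m" using shift yc by (metis nat_pow_pow T.hom_closed)
  finally show ?thesis using that yc j by blast
qed

end

text \<open>
  Commuting operators preserve each other's eigenspaces, so the operators can be treated one after
  the other, each time replacing \<open>G\<close> by the eigenspace just found.
\<close>

lemma exists_common_eigenvector: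
  assumes "comm_group G" "Factorial_Ring.prime (p::nat)" "\<And>x. x \<in> carrier G \<Longrightarrow> x [^]\<^bsub>G\<^esub> p = \<one>\<^bsub>G\<^esub>"
    and "finite \<T>" "\<And>T. T \<in> \<T> \<Longrightarrow> T \<in> hom G G"
    and "\<And>T x. T \<in> \<T> \<Longrightarrow> x \<in> carrier G \<Longrightarrow> (T ^^ (p - 1)) x = x"
    and "\<And>S T x. S \<in> \<T> \<Longrightarrow> T \<in> \<T> \<Longrightarrow> x \<in> carrier G \<Longrightarrow> S (T x) = T (S x)"
    and "subgroup K G" "x \<in> carrier G" "x \<notin> K"
  obtains y where "y \<in> carrier G" "y \<notin> K" "\<And>T. T \<in> \<T> \<Longrightarrow> \<exists>m::nat. T y = y [^]\<^bsub>G\<^esub> m"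
proof -
  have "\<exists>y\<in>carrier G - K. \<forall>T\<in>\<T>. \<exists>m::nat. T y = y [^]\<^bsub>G\<^esub> m"
    using assms(4,1,3,5-)
  proof (induction \<T> arbitrary: G K x rule: finite_induct)
    case empty
    then show ?case by auto
  next
    case (insert T \<T>)
    interpret comm_group G by fact
    obtain y m where y: "y \<in> carrier G" "y \<notin> K" "T y = y [^]\<^bsub>G\<^esub> (m::nat)"
      by (rule exists_eigenvector_outside_subgroup[of p T K x]) (use insert assms(2) in auto)
    interpret T: group_hom G G T
      using insert.prems(3)[of T] by unfold_locales auto
    define E where "E = {v \<in> carrier G. T v = v [^]\<^bsub>G\<^esub> m}"
    have E: "subgroup E G"
      by (rule subgroupI) (auto simp: E_def nat_pow_distrib nat_pow_inv intro: exI[of _ "\<one>\<^bsub>G\<^esub>"])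
    let ?E = "G\<lparr>carrier := E\<rparr>"
    have "\<exists>z\<in>carrier ?E - K \<inter> E. \<forall>T\<in>\<T>. \<exists>m::nat. T z = z [^]\<^bsub>?E\<^esub> m"
    proof (rule insert.IH)
      show "comm_group ?E"
        using E subgroup.subset[OF E] by (intro group.group_comm_groupI subgroup_imp_group)
          (auto intro: m_comm)
      show "subgroup (K \<inter> E) ?E"
        using subgroups_Inter_pair[OF insert.prems(6) E] E subgroup.subset[OF E]
        by (intro subgroup_incl) auto
      show "y \<in> carrier ?E" "y \<notin> K \<inter> E" using y by (auto simp: E_def)
      show "S \<in> hom ?E ?E" if S: "S \<in> \<T>" for S
      proof -
        interpret S: group_hom G G S
          using insert.prems(3)[of S] S by unfold_locales auto
        have "T (S v) = S v [^]\<^bsub>G\<^esub> m" if "v \<in> E" for v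
          using that insert.prems(5)[of S T v] S by (auto simp: E_def S.hom_nat_pow)
        then show ?thesis by (auto simp: hom_def E_def)
      qed
    qed (use insert.prems in \<open>auto simp: E_def nat_pow_consistent[symmetric]\<close>)
    then obtain z where z: "z \<in> E" "z \<notin> K" "\<forall>T\<in>\<T>. \<exists>m::nat. T z = z [^]\<^bsub>G\<^esub> m"
      by (auto simp: nat_pow_consistent[symmetric])
    then show ?case by (auto simp: E_def)
  qed
  then show ?thesis using that by blast
qed

section \<open>Elementwise descriptions of the classes\<close>

lemma (in group) group_exponent_dvd_iff:
  "group_exponent G dvd n \<longleftrightarrow> (\<forall>x\<in>carrier G. x [^] n = \<one>)"
  by (simp add: group_exponent_def Lcm_dvd_iff pow_eq_id)

lemma mem_Ab_exp_iff:
  "G \<in> Ab_exp n \<longleftrightarrow> comm_group G \<and> finite (carrier G) \<and> (\<forall>x\<in>carrier G. x [^]\<^bsub>G\<^esub> n = \<one>\<^bsub>G\<^esub>)"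
  unfolding Ab_exp_def Ab_def
  using group.group_exponent_dvd_iff[of G n] comm_group.axioms(2)[of G] by auto

lemma (in group) comm_group_subgroup_iff:
  assumes "subgroup H G"
  shows "comm_group (G\<lparr>carrier := H\<rparr>) \<longleftrightarrow> (\<forall>x\<in>H. \<forall>y\<in>H. x \<otimes> y = y \<otimes> x)"
proof
  assume "comm_group (G\<lparr>carrier := H\<rparr>)"
  then interpret H: comm_group "G\<lparr>carrier := H\<rparr>" .
  show "\<forall>x\<in>H. \<forall>y\<in>H. x \<otimes> y = y \<otimes> x" using H.m_comm by simp
next
  assume "\<forall>x\<in>H. \<forall>y\<in>H. x \<otimes> y = y \<otimes> x"
  then show "comm_group (G\<lparr>carrier := H\<rparr>)"
    using assms by (intro group.group_comm_groupI subgroup_imp_group) auto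
qed

lemma (in group) exists_nat_copy:
  assumes "finite (carrier G)"
  obtains K :: "nat monoid" and h where "group K" "finite (carrier K)" "h \<in> iso G K"
proof -
  obtain f :: "'a \<Rightarrow> nat" where f: "inj_on f (carrier G)"
    using finite_imp_inj_to_nat_seg[OF assms] by blast
  show ?thesis
    using that[of "image_group f G" f] inj_imp_image_group_iso[OF f]
      inj_imp_image_group_is_group[OF f] assms
    by (simp add: image_group_carrier)
qed

text \<open>
  Membership through a copy on \<open>nat\<close> is all that is known about a product of members; this is how
  such a product is put to use.
\<close>

lemma pseudovariety_epimorphic_image:
  assumes "pseudovariety W" "in_class G W" "h \<in> epi G (K :: nat monoid)" "group K"
  shows "K \<in> W"
proof -
  obtain H where H: "H \<in> W" "group G" "G \<cong> H"
    using assms(2) by (auto simp: in_class_def)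
  have "group H" using H assms(1) by (auto simp: pseudovariety_def)
  obtain f where f: "f \<in> iso H G"
    using group.iso_sym[OF H(2,3)] by (auto simp: is_iso_def)
  then have "f \<in> epi H G" by (simp add: iso_iff_mon_epi)
  then have "h \<circ> f \<in> hom H K" "(h \<circ> f) ` carrier H = carrier K"
    using assms(3) hom_compose[of f H G h K] image_comp[of h f "carrier H"] by (auto simp only: epi_def)
  then show ?thesis
    using assms(1,4) H(1) unfolding pseudovariety_def by blast
qed

lemma pv_join_superset: "V \<in> \<V> \<Longrightarrow> V \<subseteq> pv_join \<V>"
  by (auto simp: pv_join_def)

lemma pv_join_least: "pseudovariety W \<Longrightarrow> (\<And>V. V \<in> \<V> \<Longrightarrow> V \<subseteq> W) \<Longrightarrow> pv_join \<V> \<subseteq> W"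
  by (auto simp: pv_join_def)

lemma (in group) commutator_coset_iff: 
  assumes "N \<lhd> G" "x \<in> carrier G" "y \<in> carrier G"
  shows "(N #> x) <#> (N #> y) = (N #> y) <#> (N #> x) \<longleftrightarrow> x \<otimes> y \<otimes> inv x \<otimes> inv y \<in> N"
proof -
  interpret N: normal N G by fact
  have "(N #> x) <#> (N #> y) = (N #> y) <#> (N #> x) \<longleftrightarrow> N #> (x \<otimes> y) = N #> (y \<otimes> x)"
    using assms by (simp add: N.rcos_sum)
  also have "\<dots> \<longleftrightarrow> x \<otimes> y \<in> N #> (y \<otimes> x)"
    using assms repr_independence[OF _ _ N.is_subgroup] rcos_self[OF _ N.is_subgroup] by (metis m_closed)
  also have "\<dots> \<longleftrightarrow> (x \<otimes> y) \<otimes> inv (y \<otimes> x) \<in> N"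
    using assms by (intro N.rcos_module) auto
  also have "(x \<otimes> y) \<otimes> inv (y \<otimes> x) = x \<otimes> y \<otimes> inv x \<otimes> inv y"
    using assms by (simp add: inv_mult_group m_assoc)
  finally show ?thesis .
qed

lemma (in group) coset_eq_iff:
  assumes "subgroup N G" "x \<in> carrier G"
  shows "N #> x = N \<longleftrightarrow> x \<in> N"
  using assms by (metis coset_join1 coset_join2 subgroup.subset)

text \<open>
  The product of two of these classes in terms of elements of \<open>G\<close> only, without quotient groups
  or isomorphic copies.
\<close>

lemma Ab_exp_star_iff:
  fixes G :: "nat monoid" (structure)
  shows "G \<in> Ab_exp m \<star> Ab_exp n \<longleftrightarrow> group G \<and> finite (carrier G) \<and>
    (\<exists>N. N \<lhd> G \<and> (\<forall>x\<in>N. \<forall>y\<in>N. x \<otimes>\<^bsub>G\<^esub> y = y \<otimes>\<^bsub>G\<^esub> x) \<and> (\<forall>x\<in>N. x [^]\<^bsub>G\<^esub> m = \<one>\<^bsub>G\<^esub>) \<and>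
      derived G (carrier G) \<subseteq> N \<and> (\<forall>g\<in>carrier G. g [^]\<^bsub>G\<^esub> n \<in> N))"
proof -
  have "G\<lparr>carrier := N\<rparr> \<in> Ab_exp m \<longleftrightarrow>
      (\<forall>x\<in>N. \<forall>y\<in>N. x \<otimes>\<^bsub>G\<^esub> y = y \<otimes>\<^bsub>G\<^esub> x) \<and> (\<forall>x\<in>N. x [^]\<^bsub>G\<^esub> m = \<one>\<^bsub>G\<^esub>)"
    and "in_class (G Mod N) (Ab_exp n) \<longleftrightarrow>
      derived G (carrier G) \<subseteq> N \<and> (\<forall>g\<in>carrier G. g [^]\<^bsub>G\<^esub> n \<in> N)"
    if "group G" and fin: "finite (carrier G)" and N: "N \<lhd> G" for N
  proof -
    interpret group G by fact
    interpret N: normal N G by fact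
    show "G\<lparr>carrier := N\<rparr> \<in> Ab_exp m \<longleftrightarrow>
      (\<forall>x\<in>N. \<forall>y\<in>N. x \<otimes> y = y \<otimes> x) \<and> (\<forall>x\<in>N. x [^] m = \<one>)"
      using finite_subset[OF N.subset fin]
      by (auto simp: mem_Ab_exp_iff comm_group_subgroup_iff N.is_subgroup nat_pow_consistent[symmetric])
    interpret Q: group "G Mod N" by (rule N.factorgroup_is_group)
    have finQ: "finite (carrier (G Mod N))" using fin by (simp add: carrier_FactGroup)
    have pow: "(\<forall>C\<in>carrier (G Mod N). C [^]\<^bsub>G Mod N\<^esub> n = \<one>\<^bsub>G Mod N\<^esub>) \<longleftrightarrow>
        (\<forall>g\<in>carrier G. g [^] n \<in> N)"
      by (simp add: carrier_FactGroup N.FactGroup_pow coset_eq_iff N.is_subgroup)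
    have "comm_group (G Mod N) \<longleftrightarrow> (\<forall>C\<in>carrier (G Mod N). \<forall>D\<in>carrier (G Mod N). C <#> D = D <#> C)"
    proof
      assume "comm_group (G Mod N)"
      then show "\<forall>C\<in>carrier (G Mod N). \<forall>D\<in>carrier (G Mod N). C <#> D = D <#> C"
        using comm_monoid.m_comm[OF comm_group.axioms(1)] by fastforce
    next
      assume "\<forall>C\<in>carrier (G Mod N). \<forall>D\<in>carrier (G Mod N). C <#> D = D <#> C"
      then show "comm_group (G Mod N)" by (intro Q.group_comm_groupI) auto
    qed
    also have "\<dots> \<longleftrightarrow> (\<forall>x\<in>carrier G. \<forall>y\<in>carrier G. x \<otimes> y \<otimes> inv x \<otimes> inv y \<in> N)"
      by (simp add: carrier_FactGroup commutator_coset_iff N)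
    also have "\<dots> \<longleftrightarrow> derived_set G (carrier G) \<subseteq> N" by blast
    also have "\<dots> \<longleftrightarrow> derived G (carrier G) \<subseteq> N"
      unfolding derived_def
      using generate_subgroup_incl[OF _ N.is_subgroup] generate.incl[of _ "derived_set G (carrier G)" G] by blast
    finally have comm: "comm_group (G Mod N) \<longleftrightarrow> derived G (carrier G) \<subseteq> N" .
    show "in_class (G Mod N) (Ab_exp n) \<longleftrightarrow>
      derived G (carrier G) \<subseteq> N \<and> (\<forall>g\<in>carrier G. g [^] n \<in> N)"
    proof
      assume "in_class (G Mod N) (Ab_exp n)"
      then obtain H h where H: "H \<in> Ab_exp n" and h: "h \<in> iso H (G Mod N)"
        unfolding in_class_def by (metis Q.iso_sym is_iso_def ex_in_conv)
      then interpret H: comm_group H by (simp add: mem_Ab_exp_iff)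
      have "comm_group (G Mod N)"
        using H.iso_imp_comm_group[OF is_isoI[OF h]] Q.is_monoid by blast
      moreover have "\<forall>C\<in>carrier (G Mod N). C [^]\<^bsub>G Mod N\<^esub> n = \<one>\<^bsub>G Mod N\<^esub>"
      proof
        fix C assume "C \<in> carrier (G Mod N)"
        moreover have "h ` carrier H = carrier (G Mod N)" using h by (auto simp: iso_def bij_betw_def)
        ultimately obtain x where x: "x \<in> carrier H" "C = h x" by blast
        interpret h: group_hom H "G Mod N" h using h by unfold_locales (simp add: iso_def)
        show "C [^]\<^bsub>G Mod N\<^esub> n = \<one>\<^bsub>G Mod N\<^esub>"
          using H x h.hom_nat_pow[of x n, symmetric] by (simp add: mem_Ab_exp_iff del: one_FactGroup)
      qed
      ultimately show "derived G (carrier G) \<subseteq> N \<and> (\<forall>g\<in>carrier G. g [^] n \<in> N)"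
        using comm pow by simp
    next
      assume R: "derived G (carrier G) \<subseteq> N \<and> (\<forall>g\<in>carrier G. g [^] n \<in> N)"
      then interpret Qc: comm_group "G Mod N" using comm by simp
      obtain K :: "nat monoid" and h where K: "group K" "finite (carrier K)" "h \<in> iso (G Mod N) K"
        using Q.exists_nat_copy[OF finQ] by blast
      interpret h: group_hom "G Mod N" K h
        using K Q.is_group by (simp add: group_hom_def group_hom_axioms_def iso_def)
      have "comm_group K" using Qc.iso_imp_comm_group[OF is_isoI[OF K(3)]] h.H.is_monoid by blast
      moreover have "C [^]\<^bsub>K\<^esub> n = \<one>\<^bsub>K\<^esub>" if "C \<in> carrier K" for C
      proof -
        have "h ` carrier (G Mod N) = carrier K" using K(3) by (auto simp: iso_def bij_betw_def)
        then obtain x where "x \<in> carrier (G Mod N)" "C = h x" using \<open>C \<in> carrier K\<close> by blast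
        then show ?thesis using R pow h.hom_nat_pow[of x n, symmetric] h.hom_one by simp
      qed
      ultimately have "K \<in> Ab_exp n" using K by (simp add: mem_Ab_exp_iff)
      then show "in_class (G Mod N) (Ab_exp n)"
        using K(3) Q.is_group by (auto simp: in_class_def is_iso_def)
    qed
  qed
  then show ?thesis unfolding pv_prod_def by blast
qed

lemma Ab_exp_subset_star: "Ab_exp n \<subseteq> Ab_exp m \<star> Ab_exp n"
proof
  fix G assume G: "G \<in> Ab_exp n"
  then interpret comm_group G by (simp add: mem_Ab_exp_iff)
  show "G \<in> Ab_exp m \<star> Ab_exp n"
    unfolding Ab_exp_star_iff
    using G one_is_normal derived_eq_singleton[of "carrier G"]
    by (auto simp: mem_Ab_exp_iff intro!: exI[of _ "{\<one>\<^bsub>G\<^esub>}"])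
qed

lemma (in comm_group) split_coprime_exponent:
  fixes m n :: nat
  assumes "x \<in> carrier G" "coprime m n" "x [^] (m * n) = \<one>"
  obtains y z where "y \<in> carrier G" "z \<in> carrier G" "y [^] m = \<one>" "z [^] n = \<one>" "x = y \<otimes> z"
proof -
  obtain u v :: int where uv: "u * int m + v * int n = 1"
    using assms(2) bezout_int[of "int m" "int n"] by (auto simp: coprime_iff_gcd_eq_1)
  have one: "x [^] (int m * int n) = \<one>" using assms(3) by (simp flip: int_pow_int)
  have "x = x [^] (v * int n) \<otimes> x [^] (u * int m)"
    using assms(1) uv by (simp add: add.commute flip: int_pow_mult)
  moreover have "(x [^] (v * int n)) [^] m = \<one>"
  proof -
    have "(x [^] (v * int n)) [^] m = (x [^] (int m * int n)) [^] v"
      using assms(1) by (simp add: int_pow_pow mult_ac flip: int_pow_int)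
    then show ?thesis using one by simp
  qed
  moreover have "(x [^] (u * int m)) [^] n = \<one>"
  proof -
    have "(x [^] (u * int m)) [^] n = (x [^] (int m * int n)) [^] u"
      using assms(1) by (simp add: int_pow_pow mult_ac flip: int_pow_int)
    then show ?thesis using one by simp
  qed
  ultimately show ?thesis
    using that[of "x [^] (v * int n)" "x [^] (u * int m)"] assms(1) by simp
qed

section \<open>Finite abelian groups lie in the join\<close>

lemma pseudovariety_product_group:
  fixes I :: "nat set" and F :: "nat \<Rightarrow> nat monoid"
  assumes "pseudovariety W" "finite I" "\<And>i. i \<in> I \<Longrightarrow> F i \<in> W"
  shows "in_class (product_group I F) W"
  using assms by (simp add: pseudovariety_def)

text \<open>
  An abelian group of exponent dividing \<open>m * n\<close> is the image of the product of its \<open>m\<close>-torsion and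
  \<open>n\<close>-torsion subgroups under multiplication.
\<close>

lemma pseudovariety_contains_coprime_exponents:
  assumes W: "pseudovariety W" and mn: "coprime m n"
    and sub: "Ab_exp m \<subseteq> W" "Ab_exp n \<subseteq> W"
  shows "Ab_exp (m * n) \<subseteq> W"
proof
  fix G assume G: "G \<in> Ab_exp (m * n)"
  interpret comm_group G using G by (simp add: mem_Ab_exp_iff)
  have fin: "finite (carrier G)" and exp: "\<And>x. x \<in> carrier G \<Longrightarrow> x [^]\<^bsub>G\<^esub> (m * n) = \<one>\<^bsub>G\<^esub>"
    using G by (auto simp: mem_Ab_exp_iff)
  define S where "S k = {x \<in> carrier G. x [^]\<^bsub>G\<^esub> (k::nat) = \<one>\<^bsub>G\<^esub>}" for k
  have S: "subgroup (S k) G" for k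
    by (rule subgroupI) (auto simp: S_def nat_pow_distrib nat_pow_inv intro: exI[of _ "\<one>\<^bsub>G\<^esub>"])
  have Sk: "S k \<subseteq> carrier G" for k by (auto simp: S_def)
  have "comm_group (G\<lparr>carrier := S k\<rparr>)" for k
    unfolding comm_group_subgroup_iff[OF S] using m_comm Sk by blast
  then have "G\<lparr>carrier := S k\<rparr> \<in> Ab_exp k" for k
    unfolding mem_Ab_exp_iff using finite_subset[OF Sk fin]
    by (simp add: S_def nat_pow_consistent[symmetric])
  then have mem: "G\<lparr>carrier := S m\<rparr> \<in> W" "G\<lparr>carrier := S n\<rparr> \<in> W" using sub by auto
  define F where "F i = G\<lparr>carrier := S (if i = 0 then m else n)\<rparr>" for i :: nat
  let ?P = "product_group {0, 1} F"
  have "\<forall>i\<in>{0, 1}. F i \<in> W" using mem by (simp add: F_def)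
  then have P: "in_class ?P W" using W by (auto intro: pseudovariety_product_group)
  moreover have "(\<lambda>f. f 0 \<otimes>\<^bsub>G\<^esub> f 1) \<in> epi ?P G"
    unfolding epi_def
  proof (intro CollectI conjI homI)
    show "f 0 \<otimes>\<^bsub>G\<^esub> f 1 \<in> carrier G" if "f \<in> carrier ?P" for f
      using that by (auto simp: F_def S_def PiE_iff)
    show "(f \<otimes>\<^bsub>?P\<^esub> g) 0 \<otimes>\<^bsub>G\<^esub> (f \<otimes>\<^bsub>?P\<^esub> g) 1 = f 0 \<otimes>\<^bsub>G\<^esub> f 1 \<otimes>\<^bsub>G\<^esub> (g 0 \<otimes>\<^bsub>G\<^esub> g 1)"
      if "f \<in> carrier ?P" "g \<in> carrier ?P" for f g
      using that by (auto simp: F_def S_def PiE_iff m_ac)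
    show "(\<lambda>f. f 0 \<otimes>\<^bsub>G\<^esub> f 1) ` carrier ?P = carrier G"
    proof (intro equalityI subsetI)
      fix x assume x: "x \<in> carrier G"
      obtain y z where yz: "y \<in> S m" "z \<in> S n" "x = y \<otimes>\<^bsub>G\<^esub> z"
        using split_coprime_exponent[OF x mn exp[OF x]] unfolding S_def by blast
      let ?f = "\<lambda>i\<in>{0, 1::nat}. if i = 0 then y else z"
      have "?f \<in> carrier ?P" using yz by (auto simp: F_def)
      moreover have "x = ?f 0 \<otimes>\<^bsub>G\<^esub> ?f 1" using yz by simp
      ultimately show "x \<in> (\<lambda>f. f 0 \<otimes>\<^bsub>G\<^esub> f 1) ` carrier ?P" by blast
    qed (auto simp: F_def S_def PiE_iff)
  qed
  ultimately show "G \<in> W"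
    using pseudovariety_epimorphic_image[OF W] is_group by blast
qed

text \<open>
  Only prime powers \<open>q ^ k\<close> need a suitable prime \<open>p\<close> with \<open>q ^ k dvd p - 1\<close>; closure under
  products and images assembles the remaining exponents from their prime power parts.
\<close>

lemma Ab_subset_pseudovariety:
  assumes W: "pseudovariety W" and gen: "\<And>p. Factorial_Ring.prime p \<Longrightarrow> Ab_exp (p - 1) \<subseteq> W"
  shows "Ab \<subseteq> W"
proof -
  have primepow: "Ab_exp (q ^ k) \<subseteq> W" if q: "Factorial_Ring.prime q" for q k :: nat
  proof -
    obtain p where "Factorial_Ring.prime p" "q ^ k dvd p - 1"
      using exists_prime_cong_one_mod_prime_power[OF q] .
    then show ?thesis using gen[of p] dvd_trans[of _ "q ^ k" "p - 1"]
      unfolding Ab_exp_def by blast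
  qed
  have "Ab_exp n \<subseteq> W" if "n > 0" for n
    using that
  proof (induction n rule: less_induct)
    case (less n)
    show ?case
    proof (cases "n = 1")
      case True
      then show ?thesis using primepow[of 2 0] by simp
    next
      case False
      then obtain q where q: "Factorial_Ring.prime q" "q dvd n" using prime_factor_nat by blast
      define k where "k = multiplicity q n"
      obtain m where m: "n = q ^ k * m" "\<not> q dvd m"
        unfolding k_def using less.prems q(1)
        by (metis multiplicity_decompose' not_prime_unit gr_implies_not0)
      have "k > 0" using m q(2) by (cases k) auto
      have "m > 0" using m less.prems by (cases m) auto
      have "q ^ k > 1" using prime_gt_1_nat[OF q(1)] \<open>k > 0\<close> by (rule one_less_power)
      then have "m < n" using m \<open>m > 0\<close> by simp
      then have "Ab_exp m \<subseteq> W" using less.IH \<open>m > 0\<close> by blast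
      moreover have "coprime (q ^ k) m" using q(1) m(2) by (simp add: prime_imp_coprime)
      ultimately show ?thesis
        unfolding m(1) using \<open>q ^ k > 1\<close> \<open>m > 0\<close> primepow[OF q(1)] prime_gt_0_nat[OF q(1)]
        by (intro pseudovariety_contains_coprime_exponents[OF W]) auto
    qed
  qed
  moreover have "G \<in> Ab_exp (order G)" "order G > 0" if "G \<in> Ab" for G
  proof -
    have G: "comm_group G" "finite (carrier G)" using that by (auto simp: Ab_def)
    then interpret comm_group G by blast
    show "G \<in> Ab_exp (order G)" "order G > 0"
      using G pow_order_eq_1 by (auto simp: mem_Ab_exp_iff order_gt_0_iff_finite)
  qed
  ultimately show ?thesis by blast
qed

section \<open>A pseudovariety containing the generators\<close>

text \<open>
  Let \<open>P\<close> be a finite set of primes. For \<open>p \<in> P\<close> the powers \<open>x [^] (\<Prod>(P - {p}))\<close> with \<open>x\<close> in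
  the derived subgroup \<open>G'\<close> form its \<open>p\<close>-primary component, because \<open>G'\<close> is abelian and its
  exponent divides the squarefree number \<open>\<Prod>P\<close>. The last clause says that \<open>G\<close> acts on this
  component by operators \<open>T\<close> with \<open>T ^ (p - 1) = 1\<close>; these are diagonalizable over \<open>GF(p)\<close>. Writing the component as a set of powers
  makes the condition an identity, so that it passes to subgroups and images without effort.
\<close>

definition diagonalizable_derived :: "nat set \<Rightarrow> ('a, 'b) monoid_scheme \<Rightarrow> bool" where
  "diagonalizable_derived P G \<longleftrightarrow> group G \<and>
     (\<forall>x\<in>derived G (carrier G). \<forall>y\<in>derived G (carrier G). x \<otimes>\<^bsub>G\<^esub> y = y \<otimes>\<^bsub>G\<^esub> x) \<and>
     (\<forall>x\<in>derived G (carrier G). x [^]\<^bsub>G\<^esub> (\<Prod>P) = \<one>\<^bsub>G\<^esub>) \<and>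
     (\<forall>p\<in>P. \<forall>g\<in>carrier G. \<forall>x\<in>derived G (carrier G).
        g [^]\<^bsub>G\<^esub> (p - 1) \<otimes>\<^bsub>G\<^esub> x [^]\<^bsub>G\<^esub> (\<Prod>(P - {p})) = x [^]\<^bsub>G\<^esub> (\<Prod>(P - {p})) \<otimes>\<^bsub>G\<^esub> g [^]\<^bsub>G\<^esub> (p - 1))"

text \<open>
  Enlarging \<open>P\<close> only raises the elements in question to a further power, and those for the new
  primes become trivial; so the factors of a finite product can share one set of primes.
\<close>

lemma diagonalizable_derived_mono:
  assumes "diagonalizable_derived P G" "P \<subseteq> Q" "finite Q"
  shows "diagonalizable_derived Q G"
proof -
  interpret group G using assms(1) by (simp add: diagonalizable_derived_def)
  have D: "x \<in> carrier G" if "x \<in> derived G (carrier G)" for x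
    using that derived_in_carrier by blast
  have Q: "\<Prod>Q = \<Prod>P * \<Prod>(Q - P)"
    using prod.subset_diff[OF assms(2,3), of "\<lambda>x. x"] by (simp add: mult.commute)
  have one: "x [^]\<^bsub>G\<^esub> (\<Prod>P * n) = \<one>\<^bsub>G\<^esub>" if "x \<in> derived G (carrier G)" for x n
    using that assms(1) D by (simp add: diagonalizable_derived_def flip: nat_pow_pow)
  show ?thesis
    unfolding diagonalizable_derived_def
  proof (intro conjI ballI)
    fix p g x assume p: "p \<in> Q" and g: "g \<in> carrier G" and x: "x \<in> derived G (carrier G)"
    show "g [^]\<^bsub>G\<^esub> (p - 1) \<otimes>\<^bsub>G\<^esub> x [^]\<^bsub>G\<^esub> (\<Prod>(Q - {p})) = x [^]\<^bsub>G\<^esub> (\<Prod>(Q - {p})) \<otimes>\<^bsub>G\<^esub> g [^]\<^bsub>G\<^esub> (p - 1)"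
    proof (cases "p \<in> P")
      case True
      have "\<Prod>(Q - {p}) = \<Prod>(P - {p}) * \<Prod>((Q - {p}) - (P - {p}))"
        using prod.subset_diff[of "P - {p}" "Q - {p}" "\<lambda>x. x"] assms by (simp add: mult.commute Diff_mono)
      then have "x [^]\<^bsub>G\<^esub> (\<Prod>(Q - {p})) = (x [^]\<^bsub>G\<^esub> (\<Prod>(P - {p}))) [^]\<^bsub>G\<^esub> (\<Prod>((Q - {p}) - (P - {p})))"
        using D[OF x] by (simp add: nat_pow_pow)
      moreover have "g [^]\<^bsub>G\<^esub> (p - 1) \<otimes>\<^bsub>G\<^esub> x [^]\<^bsub>G\<^esub> (\<Prod>(P - {p})) = x [^]\<^bsub>G\<^esub> (\<Prod>(P - {p})) \<otimes>\<^bsub>G\<^esub> g [^]\<^bsub>G\<^esub> (p - 1)"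
        using assms(1) True g x by (simp add: diagonalizable_derived_def)
      ultimately show ?thesis
        using group_commutes_pow[OF sym] D[OF x] g by simp
    next
      case False
      then have "\<Prod>(Q - {p}) = \<Prod>P * \<Prod>((Q - {p}) - P)"
        using prod.subset_diff[of P "Q - {p}" "\<lambda>x. x"] assms by (simp add: mult.commute subset_Diff_insert)
      then show ?thesis using one[OF x] g by simp
    qed
  next
    fix x assume "x \<in> derived G (carrier G)"
    then show "x [^]\<^bsub>G\<^esub> (\<Prod>Q) = \<one>\<^bsub>G\<^esub>" unfolding Q by (rule one)
  qed (use assms(1) in \<open>simp_all add: diagonalizable_derived_def\<close>)
qed

lemma diagonalizable_derived_subgroup:
  assumes "diagonalizable_derived P G" "subgroup H G"
  shows "diagonalizable_derived P (G\<lparr>carrier := H\<rparr>)"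
proof -
  interpret group G using assms(1) by (simp add: diagonalizable_derived_def)
  have "derived (G\<lparr>carrier := H\<rparr>) H = derived G H"
    using derived_consistent[OF order_refl assms(2)] .
  moreover have "derived G H \<subseteq> derived G (carrier G)"
    using mono_derived[OF subgroup.subset[OF assms(2)]] .
  ultimately show ?thesis
    using assms subgroup_imp_group[OF assms(2)] subgroup.subset[OF assms(2)]
    unfolding diagonalizable_derived_def by (simp add: subset_iff nat_pow_consistent[symmetric])
qed

lemma diagonalizable_derived_epimorphic_image:
  assumes "diagonalizable_derived P G" "h \<in> epi G K" "group K"
  shows "diagonalizable_derived P K"
proof -
  interpret h: group_hom G K h
    using assms by (simp add: group_hom_def group_hom_axioms_def diagonalizable_derived_def epi_def)
  have K: "carrier K = h ` carrier G" using assms(2) by (auto simp: epi_def)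
  have D: "derived K (carrier K) = h ` derived G (carrier G)"
    unfolding K by (rule h.derived_img) simp
  have sub: "x \<in> carrier G" if "x \<in> derived G (carrier G)" for x
    using that h.G.derived_in_carrier by blast
  show ?thesis
    unfolding diagonalizable_derived_def D
  proof (intro conjI ballI; (elim imageE)?)
    fix x y x' y' assume "x' = h x" "x \<in> derived G (carrier G)" "y' = h y" "y \<in> derived G (carrier G)"
    then show "x' \<otimes>\<^bsub>K\<^esub> y' = y' \<otimes>\<^bsub>K\<^esub> x'"
      using assms(1) sub by (metis diagonalizable_derived_def h.hom_mult)
  next
    fix x x' assume x: "x' = h x" "x \<in> derived G (carrier G)"
    then have "x [^]\<^bsub>G\<^esub> (\<Prod>P) = \<one>\<^bsub>G\<^esub>" using assms(1) by (simp add: diagonalizable_derived_def)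
    then show "x' [^]\<^bsub>K\<^esub> (\<Prod>P) = \<one>\<^bsub>K\<^esub>"
      using x sub by (metis h.hom_nat_pow h.hom_one)
  next
    fix p g' x x' assume p: "p \<in> P" and g': "g' \<in> carrier K" and x: "x' = h x" "x \<in> derived G (carrier G)"
    then obtain g where g: "g \<in> carrier G" "g' = h g" using K by blast
    have "h (g [^]\<^bsub>G\<^esub> (p - 1) \<otimes>\<^bsub>G\<^esub> x [^]\<^bsub>G\<^esub> (\<Prod>(P - {p}))) = h (x [^]\<^bsub>G\<^esub> (\<Prod>(P - {p})) \<otimes>\<^bsub>G\<^esub> g [^]\<^bsub>G\<^esub> (p - 1))"
      using assms(1) p g x unfolding diagonalizable_derived_def by simp
    then show "g' [^]\<^bsub>K\<^esub> (p - 1) \<otimes>\<^bsub>K\<^esub> x' [^]\<^bsub>K\<^esub> (\<Prod>(P - {p})) = x' [^]\<^bsub>K\<^esub> (\<Prod>(P - {p})) \<otimes>\<^bsub>K\<^esub> g' [^]\<^bsub>K\<^esub> (p - 1)"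
      using g x sub[OF x(2)] by (simp add: h.hom_nat_pow)
  qed (rule assms(3))
qed

lemma diagonalizable_derived_product_group:
  assumes "\<And>i. i \<in> I \<Longrightarrow> diagonalizable_derived P (F i)"
  shows "diagonalizable_derived P (product_group I F)"
proof -
  let ?G = "product_group I F"
  have grp: "\<And>i. i \<in> I \<Longrightarrow> group (F i)" using assms by (simp add: diagonalizable_derived_def)
  interpret group ?G using grp by simp
  have pow: "(f [^]\<^bsub>?G\<^esub> (n::nat)) = (\<lambda>i\<in>I. f i [^]\<^bsub>F i\<^esub> n)" for f n
    by (induction n) (auto simp: fun_eq_iff restrict_def)
  have D: "f i \<in> derived (F i) (carrier (F i))" if "f \<in> derived ?G (carrier ?G)" "i \<in> I" for f i
  proof -
    interpret h: group_hom ?G "F i" "\<lambda>f. f i"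
      using that(2) grp is_group
      by (auto simp: group_hom_def group_hom_axioms_def hom_def PiE_iff)
    have "(\<lambda>f. f i) ` carrier ?G \<subseteq> carrier (F i)" using that(2) by (auto simp: PiE_iff)
    then show ?thesis
      using h.derived_img[of "carrier ?G"] that h.H.mono_derived by blast
  qed
  show ?thesis
    unfolding diagonalizable_derived_def
  proof (intro conjI ballI)
    fix f g assume "f \<in> derived ?G (carrier ?G)" "g \<in> derived ?G (carrier ?G)"
    then show "f \<otimes>\<^bsub>?G\<^esub> g = g \<otimes>\<^bsub>?G\<^esub> f"
      using D assms by (auto simp: diagonalizable_derived_def intro!: restrict_ext)
  next
    fix f assume "f \<in> derived ?G (carrier ?G)"
    then show "f [^]\<^bsub>?G\<^esub> (\<Prod>P) = \<one>\<^bsub>?G\<^esub>"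
      using D assms by (auto simp: diagonalizable_derived_def pow intro!: restrict_ext)
  next
    fix p g f assume "p \<in> P" "g \<in> carrier ?G" "f \<in> derived ?G (carrier ?G)"
    then show "g [^]\<^bsub>?G\<^esub> (p - 1) \<otimes>\<^bsub>?G\<^esub> f [^]\<^bsub>?G\<^esub> (\<Prod>(P - {p})) = f [^]\<^bsub>?G\<^esub> (\<Prod>(P - {p})) \<otimes>\<^bsub>?G\<^esub> g [^]\<^bsub>?G\<^esub> (p - 1)"
      using D assms by (auto simp: diagonalizable_derived_def pow PiE_iff intro!: restrict_ext)
  qed simp
qed

text \<open>
  Restricting to odd primes loses none of the generators of the join, because the one for
  \<open>p = 2\<close> consists of abelian groups, but it keeps out all groups whose derived subgroup has an element of order two.
\<close>

definition odd_diagonalizable :: "nat monoid set" where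
  "odd_diagonalizable = {G. finite (carrier G) \<and>
     (\<exists>P. finite P \<and> (\<forall>p\<in>P. Factorial_Ring.prime p \<and> odd p) \<and> diagonalizable_derived P G)}"

lemma pseudovariety_odd_diagonalizable: "pseudovariety odd_diagonalizable"
  unfolding pseudovariety_def
proof (intro conjI ballI allI impI; (elim conjE)?)
  fix G assume "G \<in> odd_diagonalizable"
  then show "group G" "finite (carrier G)" by (auto simp: odd_diagonalizable_def diagonalizable_derived_def)
next
  fix G H assume G: "G \<in> odd_diagonalizable" and H: "subgroup H G"
  then show "G\<lparr>carrier := H\<rparr> \<in> odd_diagonalizable"
    using diagonalizable_derived_subgroup[OF _ H] finite_subset[OF subgroup.subset[OF H]]
    by (auto simp: odd_diagonalizable_def)
next
  fix G and K :: "nat monoid" and h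
  assume "G \<in> odd_diagonalizable" "group K" "h \<in> hom G K" "h ` carrier G = carrier K"
  moreover from this have "h \<in> epi G K" by (simp add: epi_def)
  ultimately show "K \<in> odd_diagonalizable"
    using diagonalizable_derived_epimorphic_image[of _ G h K] finite_imageI[of "carrier G" h]
    by (auto simp: odd_diagonalizable_def)
next
  fix I :: "nat set" and F :: "nat \<Rightarrow> nat monoid"
  assume I: "finite I" and F: "\<forall>i\<in>I. F i \<in> odd_diagonalizable"
  then obtain P where P: "\<And>i. i \<in> I \<Longrightarrow> finite (P i)"
    "\<And>i p. i \<in> I \<Longrightarrow> p \<in> P i \<Longrightarrow> Factorial_Ring.prime p \<and> odd p" "\<And>i. i \<in> I \<Longrightarrow> diagonalizable_derived (P i) (F i)"
    unfolding odd_diagonalizable_def by simp metis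
  let ?P = "\<Union>i\<in>I. P i"
  have finP: "finite ?P" using I P(1) by blast
  have eig: "diagonalizable_derived ?P (product_group I F)"
    using P(3) finP by (intro diagonalizable_derived_product_group diagonalizable_derived_mono[OF P(3)]) auto
  interpret G: group "product_group I F" using eig by (simp add: diagonalizable_derived_def)
  have "finite (carrier (product_group I F))"
    using I F by (auto simp: odd_diagonalizable_def intro!: finite_PiE)
  then obtain K :: "nat monoid" and h where K: "group K" "finite (carrier K)" "h \<in> iso (product_group I F) K"
    using G.exists_nat_copy by blast
  have "h \<in> epi (product_group I F) K" using K(3) by (simp add: iso_iff_mon_epi)
  then have "diagonalizable_derived ?P K" using diagonalizable_derived_epimorphic_image[OF eig _ K(1)] by blast
  then have "K \<in> odd_diagonalizable" using K(2) finP P(2) unfolding odd_diagonalizable_def by blast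
  then show "in_class (product_group I F) odd_diagonalizable"
    using K(3) G.is_group by (auto simp: in_class_def is_iso_def)
qed

text \<open>
  The derived subgroup lies in the normal subgroup \<open>N\<close> of exponent \<open>p\<close>, and \<open>g ^ (p - 1)\<close> lies
  in \<open>N\<close> as well; as \<open>N\<close> is abelian, the two commute. For \<open>p = 2\<close> the group is abelian,
  and the empty set of primes serves.
\<close>

lemma Ab_exp_star_subset_odd_diagonalizable:
  assumes p: "Factorial_Ring.prime p"
  shows "Ab_exp p \<star> Ab_exp (p - 1) \<subseteq> odd_diagonalizable"
proof
  fix G assume G: "G \<in> Ab_exp p \<star> Ab_exp (p - 1)"
  obtain N where N: "group G" "finite (carrier G)" "N \<lhd> G"
    and comm: "\<And>x y. x \<in> N \<Longrightarrow> y \<in> N \<Longrightarrow> x \<otimes>\<^bsub>G\<^esub> y = y \<otimes>\<^bsub>G\<^esub> x"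
    and exp: "\<And>x. x \<in> N \<Longrightarrow> x [^]\<^bsub>G\<^esub> p = \<one>\<^bsub>G\<^esub>"
    and der: "derived G (carrier G) \<subseteq> N" and pow: "\<And>g. g \<in> carrier G \<Longrightarrow> g [^]\<^bsub>G\<^esub> (p - 1) \<in> N"
    using G[unfolded Ab_exp_star_iff] by (elim conjE exE, intro that) blast+
  interpret group G by fact
  interpret N: normal N G by fact
  show "G \<in> odd_diagonalizable"
  proof (cases "p = 2")
    case True
    then have "carrier G \<subseteq> N" using pow by auto
    then interpret comm_group G using comm by (intro group_comm_groupI) auto
    have "diagonalizable_derived {} G"
      using derived_eq_singleton[of "carrier G"] is_group by (simp add: diagonalizable_derived_def)
    then show ?thesis using N(2) unfolding odd_diagonalizable_def by blast
  next
    case False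
    then have "odd p" using p primes_dvd_imp_eq two_is_prime_nat by blast
    moreover have "diagonalizable_derived {p} G"
      using der comm exp pow is_group N.subset unfolding diagonalizable_derived_def by (auto simp: subset_iff)
    ultimately show ?thesis using N(2) p unfolding odd_diagonalizable_def by blast
  qed
qed

section \<open>Supersolvability\<close>

lemma (in group) conjugation_hom:
  assumes "g \<in> carrier G"
  shows "group_hom G G (\<lambda>x. g \<otimes> x \<otimes> inv g)"
proof -
  have "g \<otimes> (x \<otimes> y) \<otimes> inv g = (g \<otimes> x \<otimes> inv g) \<otimes> (g \<otimes> y \<otimes> inv g)"
    if "x \<in> carrier G" "y \<in> carrier G" for x y
    using assms that by (simp add: m_assoc inv_solve_left)
  then show ?thesis
    using assms is_group by (auto simp: group_hom_def group_hom_axioms_def hom_def)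
qed

text \<open>
  If conjugation maps \<open>y\<close> to a power of itself modulo \<open>K\<close>, then \<open>K\<close> and \<open>y\<close> together generate a
  normal subgroup, which by minimality is \<open>H\<close>.
\<close>

lemma (in group) cyclic_chief_factor:
  assumes cf: "chief_factor G H K" and y: "y \<in> H" "y \<notin> K"
    and conj: "\<And>g. g \<in> carrier G \<Longrightarrow> \<exists>k\<in>K. \<exists>m::int. g \<otimes> y \<otimes> inv g = k \<otimes> y [^] m"
  shows "cyclic_group (G\<lparr>carrier := H\<rparr> Mod K)"
proof -
  interpret K: normal K G using cf by (simp add: chief_factor_def)
  interpret H: normal H G using cf by (simp add: chief_factor_def)
  interpret Q: group "G Mod K" by (rule K.factorgroup_is_group)
  interpret pi: group_hom G "G Mod K" "\<lambda>a. K #> a"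
    using K.r_coset_hom_Mod is_group Q.is_group by (simp add: group_hom_def group_hom_axioms_def)
  have KH: "K \<subseteq> H" using cf by (auto simp: chief_factor_def)
  have yc: "y \<in> carrier G" using y H.subset by blast
  have yH: "y [^] (n::int) \<in> H" for n
    using subgroup_int_pow_closed[OF H.is_subgroup y(1)] .
  have kcos: "K #> (k \<otimes> a) = K #> a" if "k \<in> K" "a \<in> carrier G" for k a
    using that by (metis K.subset coset_join2 coset_mult_assoc K.mem_carrier K.is_subgroup)
  define L where "L = {l \<in> carrier G. \<exists>n::int. K #> l = K #> y [^] n}"
  have "subgroup L G"
  proof (rule subgroupI)
    show "L \<subseteq> carrier G" by (auto simp: L_def)
    show "L \<noteq> {}" using yc by (auto simp: L_def intro!: exI[of _ y] exI[of _ 1])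
  next
    fix l assume "l \<in> L"
    then obtain n :: int where l: "l \<in> carrier G" "K #> l = K #> y [^] n" by (auto simp: L_def)
    have "K #> inv l = K #> inv (y [^] n)" using l yc pi.hom_inv int_pow_closed by metis
    then have "K #> inv l = K #> y [^] (- n)" using yc by (simp add: int_pow_neg)
    then show "inv l \<in> L" using l(1) unfolding L_def by blast
  next
    fix l l' assume "l \<in> L" "l' \<in> L"
    then obtain n n' :: int where l: "l \<in> carrier G" "K #> l = K #> y [^] n"
      "l' \<in> carrier G" "K #> l' = K #> y [^] n'" by (auto simp: L_def)
    then have "K #> (l \<otimes> l') = K #> (y [^] n \<otimes> y [^] n')" using yc pi.hom_mult int_pow_closed by metis
    then have "K #> (l \<otimes> l') = K #> y [^] (n + n')" using yc by (simp add: int_pow_mult)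
    then show "l \<otimes> l' \<in> L" using l unfolding L_def by blast
  qed
  moreover have "g \<otimes> l \<otimes> inv g \<in> L" if g: "g \<in> carrier G" and "l \<in> L" for g l
  proof -
    interpret c: group_hom G G "\<lambda>x. g \<otimes> x \<otimes> inv g" using conjugation_hom[OF g] .
    obtain n :: int where l: "l \<in> carrier G" "K #> l = K #> y [^] n" using \<open>l \<in> L\<close> by (auto simp: L_def)
    obtain k m where k: "k \<in> K" "g \<otimes> y \<otimes> inv g = k \<otimes> y [^] (m::int)" using conj[OF g] by blast
    have "K #> (g \<otimes> l \<otimes> inv g) = K #> (g \<otimes> y [^] n \<otimes> inv g)"
      using g l yc by (metis pi.hom_mult m_closed inv_closed int_pow_closed)
    also have "\<dots> = K #> ((k \<otimes> y [^] m) [^] n)"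
      using c.hom_int_pow[OF yc] k(2) by simp
    also have "\<dots> = (K #> y [^] m) [^]\<^bsub>G Mod K\<^esub> n"
      using pi.hom_int_pow[of "k \<otimes> y [^] m" n] kcos[OF k(1)] k(1) yc by simp
    also have "\<dots> = K #> y [^] (m * n)"
      using pi.hom_int_pow[of "y [^] m" n] yc by (simp add: int_pow_pow)
    finally show ?thesis using g l(1) unfolding L_def by blast
  qed
  ultimately have "L \<lhd> G" by (simp add: normal_inv_iff)
  moreover have "K \<subseteq> L"
  proof
    fix k assume k: "k \<in> K"
    then have "K #> k = K #> y [^] (0::int)"
      using K.subset by (simp add: coset_eq_iff K.is_subgroup)
    then show "k \<in> L" using k K.subset unfolding L_def by blast
  qed
  moreover have "L \<subseteq> H"
  proof
    fix l assume "l \<in> L"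
    then obtain n :: int where l: "l \<in> carrier G" "K #> l = K #> y [^] n" by (auto simp: L_def)
    then obtain k where "k \<in> K" "l = k \<otimes> y [^] n"
      using rcos_self[OF l(1) K.is_subgroup] by (auto simp: r_coset_def)
    then show "l \<in> H" using KH yH by auto
  qed
  moreover have "y \<in> L" using yc by (auto simp: L_def intro!: exI[of _ 1])
  ultimately have L: "L = H" using cf y(2) unfolding chief_factor_def by blast
  interpret GH: group "G\<lparr>carrier := H\<rparr>" using subgroup_imp_group[OF H.is_subgroup] .
  interpret KH: normal K "G\<lparr>carrier := H\<rparr>"
    using normal_restrict_supergroup[OF H.is_subgroup K.normal_axioms KH] .
  interpret QH: group "G\<lparr>carrier := H\<rparr> Mod K" by (rule KH.factorgroup_is_group)
  have car: "carrier (G\<lparr>carrier := H\<rparr> Mod K) = (\<lambda>x. K #> x) ` H"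
    by (simp add: carrier_FactGroup)
  have pow: "(K #> y) [^]\<^bsub>G\<lparr>carrier := H\<rparr> Mod K\<^esub> (n::int) = K #> y [^] n" for n
    using KH.FactGroup_int_pow[of y n] y(1) int_pow_consistent[OF H.is_subgroup y(1), of n] by simp
  show ?thesis
    unfolding QH.cyclic_group
  proof (rule bexI[of _ "K #> y"])
    show "carrier (G\<lparr>carrier := H\<rparr> Mod K) = range (\<lambda>n::int. (K #> y) [^]\<^bsub>G\<lparr>carrier := H\<rparr> Mod K\<^esub> n)"
      unfolding car pow using yH L by (auto simp: L_def)
  qed (use car y in auto)
qed

text \<open>
  If \<open>G\<close> acts trivially on \<open>H / K\<close>, every nontrivial element generates it; otherwise
  some commutator survives in it.
\<close>

lemma (in group) chief_factor_cases:
  assumes "chief_factor G H K"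
  obtains "cyclic_group (G\<lparr>carrier := H\<rparr> Mod K)"
  | c where "c \<in> H" "c \<in> derived G (carrier G)" "c \<notin> K"
proof -
  interpret K: normal K G using assms by (simp add: chief_factor_def)
  interpret H: normal H G using assms by (simp add: chief_factor_def)
  obtain y where y: "y \<in> H" "y \<notin> K" using assms by (auto simp: chief_factor_def)
  have yc: "y \<in> carrier G" using y H.subset by blast
  show ?thesis
  proof (cases "\<forall>g\<in>carrier G. g \<otimes> y \<otimes> inv g \<otimes> inv y \<in> K")
    case True
    have "g \<otimes> y \<otimes> inv g = (g \<otimes> y \<otimes> inv g \<otimes> inv y) \<otimes> y [^] (1::int)" if "g \<in> carrier G" for g
      using that yc by (simp add: m_assoc)
    then have "cyclic_group (G\<lparr>carrier := H\<rparr> Mod K)"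
      using True by (intro cyclic_chief_factor[OF assms y]) blast
    then show ?thesis by (rule that(1))
  next
    case False
    then obtain g where g: "g \<in> carrier G" "g \<otimes> y \<otimes> inv g \<otimes> inv y \<notin> K" by blast
    have "g \<otimes> y \<otimes> inv g \<otimes> inv y \<in> derived_set G (carrier G)" using g yc by blast
    then have "g \<otimes> y \<otimes> inv g \<otimes> inv y \<in> derived G (carrier G)"
      unfolding derived_def by (rule generate.incl)
    moreover have "g \<otimes> y \<otimes> inv g \<otimes> inv y \<in> H"
      using H.inv_op_closed2[OF g(1) y(1)] y(1) by (simp add: H.m_closed)
    ultimately show ?thesis using that(2) g by blast
  qed
qed

lemma (in group) supersolvable_if_derived_central:
  assumes "\<And>x g. x \<in> derived G (carrier G) \<Longrightarrow> g \<in> carrier G \<Longrightarrow> g \<otimes> x = x \<otimes> g"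
  shows "supersolvable G"
  unfolding supersolvable_def
proof (intro conjI allI impI)
  fix H K assume cf: "chief_factor G H K"
  then show "cyclic_group (G\<lparr>carrier := H\<rparr> Mod K)"
  proof (cases rule: chief_factor_cases)
    case (2 c)
    interpret K: normal K G using cf by (simp add: chief_factor_def)
    have cc: "c \<in> carrier G" using 2 derived_in_carrier by blast
    have "g \<otimes> c \<otimes> inv g = \<one> \<otimes> c [^] (1::int)" if "g \<in> carrier G" for g
      using that cc assms[OF 2(2) that] by (simp add: m_assoc)
    then show ?thesis using 2 K.one_closed by (intro cyclic_chief_factor[OF cf]) blast+
  qed
qed (rule is_group)

text \<open>
  The numbers \<open>\<Prod>(P - {p})\<close> together with \<open>\<Prod>P\<close> have no common prime divisor, so the order of
  \<open>c\<close> modulo \<open>K\<close> cannot divide them all.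
\<close>

lemma (in group) exists_prime_component_outside:
  assumes K: "K \<lhd> G" and c: "c \<in> carrier G" "c \<notin> K" and P: "\<And>p. p \<in> P \<Longrightarrow> Factorial_Ring.prime (p::nat)"
    and fin: "finite P" and one: "c [^] (\<Prod>P) = \<one>"
  obtains p where "p \<in> P" "c [^] (\<Prod>(P - {p})) \<notin> K"
proof (rule ccontr)
  assume "\<not> thesis"
  then have *: "\<And>p. p \<in> P \<Longrightarrow> c [^] (\<Prod>(P - {p})) \<in> K" using that by blast
  interpret K: normal K G by fact
  interpret Q: group "G Mod K" by (rule K.factorgroup_is_group)
  define d where "d = Q.ord (K #> c)"
  have d: "d dvd n \<longleftrightarrow> c [^] n \<in> K" for n :: nat
  proof -
    have "K #> c \<in> carrier (G Mod K)" using c by (auto simp: carrier_FactGroup)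
    then show ?thesis
      unfolding d_def using c Q.pow_eq_id[of "K #> c" n]
      by (simp add: K.FactGroup_pow coset_eq_iff K.is_subgroup)
  qed
  have "d \<noteq> 1" using d[of 1] c by auto
  then obtain q where q: "Factorial_Ring.prime q" "q dvd d" using prime_factor_nat by blast
  have member: "q \<in> S" if S: "S \<subseteq> P" "q dvd \<Prod>S" for S
  proof -
    have "finite S" using S fin finite_subset by blast
    then obtain r where "r \<in> S" "q dvd r" using S q(1) prime_dvd_prod_iff[of S q "\<lambda>x. x"] by auto
    then show ?thesis using P S(1) q(1) primes_dvd_imp_eq by blast
  qed
  have "d dvd \<Prod>P" using d one K.one_closed by simp
  then have "q \<in> P" using member[of P] q(2) dvd_trans by blast
  then have "d dvd \<Prod>(P - {q})" using * d by blast
  then have "q \<in> P - {q}" using member[of "P - {q}"] q(2) dvd_trans by blast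
  then show False by simp
qed

text \<open>
  Suppose \<open>G\<close> acts nontrivially on \<open>H / K\<close>. Then some \<open>p\<close>-primary part \<open>d\<close> of an element of
  \<open>G' \<inter> H\<close> lies outside \<open>K\<close>. It belongs to the \<open>GF(p)\<close>-space \<open>V\<close> of the elements of
  order dividing \<open>p\<close> in \<open>G' \<inter> H\<close> that commute with all \<open>g ^ (p - 1)\<close>. On \<open>V\<close>
  conjugations commute because \<open>G'\<close> is abelian, and their order divides \<open>p - 1\<close>. A common
  eigenvector outside \<open>K\<close> generates a normal subgroup, which covers \<open>H / K\<close>.
\<close>

lemma supersolvable_if_diagonalizable_derived:
  assumes fin: "finite (carrier G)" and finP: "finite P"
    and P: "\<And>p. p \<in> P \<Longrightarrow> Factorial_Ring.prime (p::nat)" and eig: "diagonalizable_derived P G"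
  shows "supersolvable G"
proof -
  interpret group G using eig by (simp add: diagonalizable_derived_def)
  define D where "D = derived G (carrier G)"
  have Dn: "D \<lhd> G" unfolding D_def using derived_is_normal[OF normal_self] .
  interpret D: normal D G by (rule Dn)
  have Dcomm: "x \<otimes>\<^bsub>G\<^esub> y = y \<otimes>\<^bsub>G\<^esub> x" if "x \<in> D" "y \<in> D" for x y
    using eig that by (simp add: diagonalizable_derived_def D_def)
  show ?thesis
    unfolding supersolvable_def
  proof (intro conjI allI impI)
    fix H K assume cf: "chief_factor G H K"
    then show "cyclic_group (G\<lparr>carrier := H\<rparr> Mod K)"
    proof (cases rule: chief_factor_cases)
      case (2 c)
      interpret K: normal K G using cf by (simp add: chief_factor_def)
      interpret H: normal H G using cf by (simp add: chief_factor_def)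
      have cD: "c \<in> D" and cc: "c \<in> carrier G" using 2 D.subset by (auto simp: D_def)
      have "c [^]\<^bsub>G\<^esub> (\<Prod>P) = \<one>\<^bsub>G\<^esub>" using eig cD by (simp add: diagonalizable_derived_def D_def)
      then obtain p where p: "p \<in> P" "c [^]\<^bsub>G\<^esub> (\<Prod>(P - {p})) \<notin> K"
        using exists_prime_component_outside[OF K.normal_axioms cc 2(3) P finP] by blast
      define V where "V = {v \<in> D \<inter> H. v [^]\<^bsub>G\<^esub> p = \<one>\<^bsub>G\<^esub> \<and>
        (\<forall>g\<in>carrier G. g [^]\<^bsub>G\<^esub> (p - 1) \<otimes>\<^bsub>G\<^esub> v = v \<otimes>\<^bsub>G\<^esub> g [^]\<^bsub>G\<^esub> (p - 1))}"
      have Vc: "V \<subseteq> carrier G" using D.subset by (auto simp: V_def)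
      have V: "subgroup V G"
      proof (rule subgroupI[OF Vc])
        show "V \<noteq> {}"
          using D.one_closed H.one_closed by (auto simp: V_def intro!: exI[of _ "\<one>\<^bsub>G\<^esub>"])
      next
        fix v assume v: "v \<in> V"
        then have vc: "v \<in> carrier G" using Vc by blast
        have "g [^]\<^bsub>G\<^esub> (p - 1) \<otimes>\<^bsub>G\<^esub> inv\<^bsub>G\<^esub> v = inv\<^bsub>G\<^esub> v \<otimes>\<^bsub>G\<^esub> g [^]\<^bsub>G\<^esub> (p - 1)" if g: "g \<in> carrier G" for g
        proof -
          have "g [^]\<^bsub>G\<^esub> (p - 1) \<otimes>\<^bsub>G\<^esub> v = v \<otimes>\<^bsub>G\<^esub> g [^]\<^bsub>G\<^esub> (p - 1)" using v g by (simp add: V_def)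
          then show ?thesis
            using vc g by (metis inv_closed inv_solve_left inv_solve_right m_assoc m_closed nat_pow_closed)
        qed
        then show "inv\<^bsub>G\<^esub> v \<in> V" using v vc by (simp add: V_def nat_pow_inv)
      next
        fix v w assume v: "v \<in> V" and w: "w \<in> V"
        then have vc: "v \<in> carrier G" "w \<in> carrier G" using Vc by auto
        have "g [^]\<^bsub>G\<^esub> (p - 1) \<otimes>\<^bsub>G\<^esub> (v \<otimes>\<^bsub>G\<^esub> w) = v \<otimes>\<^bsub>G\<^esub> w \<otimes>\<^bsub>G\<^esub> g [^]\<^bsub>G\<^esub> (p - 1)" if g: "g \<in> carrier G" for g
        proof -
          have "g [^]\<^bsub>G\<^esub> (p - 1) \<otimes>\<^bsub>G\<^esub> v = v \<otimes>\<^bsub>G\<^esub> g [^]\<^bsub>G\<^esub> (p - 1)"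
            "g [^]\<^bsub>G\<^esub> (p - 1) \<otimes>\<^bsub>G\<^esub> w = w \<otimes>\<^bsub>G\<^esub> g [^]\<^bsub>G\<^esub> (p - 1)" using v w g by (simp_all add: V_def)
          then show ?thesis using vc g by (metis m_assoc nat_pow_closed)
        qed
        moreover have "(v \<otimes>\<^bsub>G\<^esub> w) [^]\<^bsub>G\<^esub> p = v [^]\<^bsub>G\<^esub> p \<otimes>\<^bsub>G\<^esub> w [^]\<^bsub>G\<^esub> p"
          using v w Dcomm vc by (intro pow_mult_distrib) (auto simp: V_def)
        ultimately show "v \<otimes>\<^bsub>G\<^esub> w \<in> V" using v w by (simp add: V_def)
      qed
      define d where "d = c [^]\<^bsub>G\<^esub> (\<Prod>(P - {p}))"
      have dV: "d \<in> V"
      proof -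
        have "d [^]\<^bsub>G\<^esub> p = c [^]\<^bsub>G\<^esub> (\<Prod>P)"
          unfolding d_def using cc prod.remove[OF finP p(1), of "\<lambda>x. x"] by (simp add: nat_pow_pow mult.commute)
        moreover have "d \<in> D" "d \<in> H"
          using subgroup_int_pow_closed[OF D.is_subgroup cD, of "int (\<Prod>(P - {p}))"]
            subgroup_int_pow_closed[OF H.is_subgroup 2(1), of "int (\<Prod>(P - {p}))"]
          unfolding d_def int_pow_int by blast+
        ultimately show ?thesis
          using eig p(1) cD by (simp add: V_def diagonalizable_derived_def D_def d_def)
      qed
      define cj where "cj g x = g \<otimes>\<^bsub>G\<^esub> x \<otimes>\<^bsub>G\<^esub> inv\<^bsub>G\<^esub> g" for g x
      have cj_hom: "group_hom G G (cj g)" if "g \<in> carrier G" for g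
        using conjugation_hom[OF that] by (simp add: cj_def[abs_def])
      have cj_mult: "cj (g \<otimes>\<^bsub>G\<^esub> h) x = cj g (cj h x)"
        if "g \<in> carrier G" "h \<in> carrier G" "x \<in> carrier G" for g h x
        using that by (simp add: cj_def m_assoc inv_mult_group)
      have cj_pow: "(cj g ^^ n) x = cj (g [^]\<^bsub>G\<^esub> n) x" if "g \<in> carrier G" "x \<in> carrier G" for g x n
      proof (induction n)
        case 0
        then show ?case using that by (simp add: cj_def)
      next
        case (Suc n)
        have "(cj g ^^ Suc n) x = cj (g \<otimes>\<^bsub>G\<^esub> g [^]\<^bsub>G\<^esub> n) x"
          using that cj_mult[of g "g [^]\<^bsub>G\<^esub> n" x] Suc by simp
        also have "g \<otimes>\<^bsub>G\<^esub> g [^]\<^bsub>G\<^esub> n = g [^]\<^bsub>G\<^esub> Suc n" using nat_pow_Suc2[OF that(1)] by (rule sym)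
        finally show ?case .
      qed
      have cj_comm: "cj g x = x" if "g \<in> carrier G" "x \<in> carrier G" "g \<otimes>\<^bsub>G\<^esub> x = x \<otimes>\<^bsub>G\<^esub> g" for g x
        using that by (simp add: cj_def m_assoc)
      have cj_V: "cj g v \<in> V" if g: "g \<in> carrier G" and v: "v \<in> V" for g v
      proof -
        interpret cj: group_hom G G "cj g" using cj_hom[OF g] .
        have vc: "v \<in> carrier G" using v Vc by blast
        have "h [^]\<^bsub>G\<^esub> (p - 1) \<otimes>\<^bsub>G\<^esub> cj g v = cj g v \<otimes>\<^bsub>G\<^esub> h [^]\<^bsub>G\<^esub> (p - 1)" if h: "h \<in> carrier G" for h
        proof -
          define h' where "h' = inv\<^bsub>G\<^esub> g \<otimes>\<^bsub>G\<^esub> h \<otimes>\<^bsub>G\<^esub> g"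
          have h': "h' \<in> carrier G" using g h by (simp add: h'_def)
          have "cj g h' = h"
            using g h by (simp add: cj_def h'_def m_assoc) (simp add: m_assoc[symmetric])
          then have "cj g (h' [^]\<^bsub>G\<^esub> (p - 1)) = h [^]\<^bsub>G\<^esub> (p - 1)" using h' by (simp add: cj.hom_nat_pow)
          moreover have "cj g (h' [^]\<^bsub>G\<^esub> (p - 1) \<otimes>\<^bsub>G\<^esub> v) = cj g (v \<otimes>\<^bsub>G\<^esub> h' [^]\<^bsub>G\<^esub> (p - 1))"
            using v h' by (simp add: V_def)
          ultimately show ?thesis using h' vc by simp
        qed
        moreover have "cj g v [^]\<^bsub>G\<^esub> p = \<one>\<^bsub>G\<^esub>"
          using v cj.hom_nat_pow[OF vc, of p] by (simp add: V_def)
        moreover have "cj g v \<in> D" "cj g v \<in> H"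
          using v D.inv_op_closed2[OF g] H.inv_op_closed2[OF g] by (auto simp: V_def cj_def)
        ultimately show ?thesis by (simp add: V_def)
      qed
      have cj_swap: "cj g (cj h v) = cj h (cj g v)"
        if g: "g \<in> carrier G" and h: "h \<in> carrier G" and v: "v \<in> V" for g h v
      proof -
        define e where "e = g \<otimes>\<^bsub>G\<^esub> h \<otimes>\<^bsub>G\<^esub> inv\<^bsub>G\<^esub> g \<otimes>\<^bsub>G\<^esub> inv\<^bsub>G\<^esub> h"
        have "e \<in> derived_set G (carrier G)" unfolding e_def using g h by blast
        then have e: "e \<in> D" unfolding D_def derived_def by (rule generate.incl)
        then have ec: "e \<in> carrier G" using D.subset by blast
        have vc: "v \<in> carrier G" using v Vc by blast
        have w: "cj h (cj g v) \<in> V" using cj_V g h v by blast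
        then have wD: "cj h (cj g v) \<in> D" by (simp add: V_def)
        \<comment> \<open>The two composites differ by conjugation with a commutator, which fixes \<open>G'\<close>.\<close>
        have "g \<otimes>\<^bsub>G\<^esub> h = e \<otimes>\<^bsub>G\<^esub> (h \<otimes>\<^bsub>G\<^esub> g)"
          unfolding e_def using g h by (simp add: m_assoc) (simp add: m_assoc[symmetric])
        then have "cj g (cj h v) = cj e (cj h (cj g v))"
          using g h ec vc by (simp flip: cj_mult)
        also have "\<dots> = cj h (cj g v)"
          using cj_comm[OF ec _ Dcomm[OF e wD]] wD D.subset by blast
        finally show ?thesis .
      qed
      let ?V = "G\<lparr>carrier := V\<rparr>"
      obtain y where y: "y \<in> carrier ?V" "y \<notin> K \<inter> V"
        "\<And>T. T \<in> cj ` carrier G \<Longrightarrow> \<exists>m::nat. T y = y [^]\<^bsub>?V\<^esub> m"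
      proof (rule exists_common_eigenvector[of ?V p "cj ` carrier G" "K \<inter> V" d])
        show "comm_group ?V"
          unfolding comm_group_subgroup_iff[OF V] using Dcomm by (auto simp: V_def)
        show "x [^]\<^bsub>?V\<^esub> p = \<one>\<^bsub>?V\<^esub>" if "x \<in> carrier ?V" for x
          using that by (simp add: V_def nat_pow_consistent[symmetric])
        show "T \<in> hom ?V ?V" if "T \<in> cj ` carrier G" for T
          using that cj_V group_hom.hom_mult[OF cj_hom] Vc by (auto simp: hom_def subset_iff)
        show "(T ^^ (p - 1)) x = x" if "T \<in> cj ` carrier G" "x \<in> carrier ?V" for T x
        proof -
          obtain g where g: "g \<in> carrier G" "T = cj g" using \<open>T \<in> cj ` carrier G\<close> by blast
          have "x \<in> V" "x \<in> carrier G" using that Vc by auto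
          then show ?thesis using g cj_comm[of "g [^]\<^bsub>G\<^esub> (p - 1)" x] by (simp add: cj_pow V_def)
        qed
        show "S (T x) = T (S x)" if "S \<in> cj ` carrier G" "T \<in> cj ` carrier G" "x \<in> carrier ?V" for S T x
          using that cj_swap by auto
        show "subgroup (K \<inter> V) ?V"
          using subgroups_Inter_pair[OF K.is_subgroup V] V by (intro subgroup_incl) auto
        show "d \<notin> K \<inter> V" using p(2) by (simp add: d_def)
      qed (use fin p(1) P dV in auto)
      have yH: "y \<in> H" "y \<notin> K" and yc: "y \<in> carrier G" using y(1,2) Vc by (auto simp: V_def)
      have "\<exists>k\<in>K. \<exists>m::int. g \<otimes>\<^bsub>G\<^esub> y \<otimes>\<^bsub>G\<^esub> inv\<^bsub>G\<^esub> g = k \<otimes>\<^bsub>G\<^esub> y [^]\<^bsub>G\<^esub> m" if "g \<in> carrier G" for g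
      proof -
        obtain m :: nat where "cj g y = y [^]\<^bsub>G\<^esub> m"
          using y(3)[of "cj g"] \<open>g \<in> carrier G\<close> by (auto simp: nat_pow_consistent[symmetric])
        then have "g \<otimes>\<^bsub>G\<^esub> y \<otimes>\<^bsub>G\<^esub> inv\<^bsub>G\<^esub> g = \<one>\<^bsub>G\<^esub> \<otimes>\<^bsub>G\<^esub> y [^]\<^bsub>G\<^esub> int m"
          using yc by (simp add: cj_def int_pow_int)
        then show ?thesis using K.one_closed by blast
      qed
      then show ?thesis by (rule cyclic_chief_factor[OF cf yH])
    qed
  qed (rule is_group)
qed

lemma odd_diagonalizable_subset_Su_Metab: "odd_diagonalizable \<subseteq> Su \<inter> Metab"
proof
  fix G assume "G \<in> odd_diagonalizable"
  then obtain P where P: "finite (carrier G)" "finite P"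
    "\<And>p. p \<in> P \<Longrightarrow> Factorial_Ring.prime p" "diagonalizable_derived P G"
    unfolding odd_diagonalizable_def by blast
  interpret group G using P(4) by (simp add: diagonalizable_derived_def)
  have "comm_group (G\<lparr>carrier := derived G (carrier G)\<rparr>)"
    using P(4) derived_is_subgroup[of "carrier G"] by (simp add: comm_group_subgroup_iff diagonalizable_derived_def)
  then show "G \<in> Su \<inter> Metab"
    using supersolvable_if_diagonalizable_derived[OF P] P(1) is_group by (simp add: Su_def Metab_def metabelian_def)
qed

section \<open>Two dihedral groups\<close>

text \<open>
  The pair \<open>(a, s)\<close> stands for the rotation by \<open>a\<close>, multiplied on the right by a fixed
  reflection if \<open>s\<close> holds.
\<close>

definition dihedral :: "nat \<Rightarrow> (int \<times> bool) monoid" where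
  "dihedral n = \<lparr>carrier = {0..<int n} \<times> UNIV,
     monoid.mult = (\<lambda>(a, s) (b, t). ((a + (if s then - b else b)) mod int n, s \<noteq> t)), one = (0, False)\<rparr>"

lemma mem_dihedral [simp]: "(a, s) \<in> carrier (dihedral n) \<longleftrightarrow> 0 \<le> a \<and> a < int n"
  by (auto simp: dihedral_def)

lemma mult_dihedral [simp]:
  "(a, s) \<otimes>\<^bsub>dihedral n\<^esub> (b, t) = ((a + (if s then - b else b)) mod int n, s \<noteq> t)"
  by (simp add: dihedral_def)

lemma one_dihedral [simp]: "\<one>\<^bsub>dihedral n\<^esub> = (0, False)"
  by (simp add: dihedral_def)

lemma rotation_pow:
  "(a mod int n, False) [^]\<^bsub>dihedral n\<^esub> k = (int k * a mod int n, False)" for k :: nat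
  by (induction k) (simp_all add: mod_simps algebra_simps)

lemma finite_dihedral: "finite (carrier (dihedral n))"
  by (simp add: dihedral_def)

lemma group_dihedral:
  assumes "n > 0"
  shows "group (dihedral n)"
proof (rule groupI; clarify?)
  fix a b c :: int and s t u :: bool
  show "(a, s) \<otimes>\<^bsub>dihedral n\<^esub> (b, t) \<otimes>\<^bsub>dihedral n\<^esub> (c, u) =
      (a, s) \<otimes>\<^bsub>dihedral n\<^esub> ((b, t) \<otimes>\<^bsub>dihedral n\<^esub> (c, u))"
    by (cases s; cases t) (simp_all add: mod_simps algebra_simps)
next
  fix a :: int and s
  assume a: "(a, s) \<in> carrier (dihedral n)"
  show "\<exists>y\<in>carrier (dihedral n). y \<otimes>\<^bsub>dihedral n\<^esub> (a, s) = \<one>\<^bsub>dihedral n\<^esub>"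
    using assms a by (intro bexI[of _ "(if s then a else - a mod int n, s)"]) (auto simp: mod_simps)
qed (use assms in \<open>auto\<close>)

lemma inv_dihedral:
  assumes "n > 0" "0 \<le> a" "a < int n"
  shows "inv\<^bsub>dihedral n\<^esub> (a, s) = (if s then a else - a mod int n, s)"
proof -
  interpret group "dihedral n" by (rule group_dihedral[OF assms(1)])
  show ?thesis using assms by (intro inv_equality) (auto simp: mod_simps)
qed

lemma derived_dihedral_subset:
  assumes "n > 0"
  shows "derived (dihedral n) (carrier (dihedral n)) \<subseteq> {(2 * a mod int n, False) | a. True}"
proof -
  interpret group "dihedral n" by (rule group_dihedral[OF assms])
  let ?E = "{(2 * a mod int n, False) | a. True}"
  have "subgroup ?E (dihedral n)"
  proof (rule subgroupI)
    show "?E \<subseteq> carrier (dihedral n)" using assms by auto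
    show "?E \<noteq> {}" by blast
  next
    fix x assume "x \<in> ?E"
    then obtain a where "x = (2 * a mod int n, False)" by blast
    then have "inv\<^bsub>dihedral n\<^esub> x = (2 * (- a) mod int n, False)"
      using assms by (simp add: inv_dihedral mod_simps)
    then show "inv\<^bsub>dihedral n\<^esub> x \<in> ?E" by blast
  next
    fix x y assume "x \<in> ?E" "y \<in> ?E"
    then obtain a b where "x = (2 * a mod int n, False)" "y = (2 * b mod int n, False)" by blast
    then have "x \<otimes>\<^bsub>dihedral n\<^esub> y = (2 * (a + b) mod int n, False)" by (simp add: mod_simps algebra_simps)
    then show "x \<otimes>\<^bsub>dihedral n\<^esub> y \<in> ?E" by blast
  qed
  moreover have "derived_set (dihedral n) (carrier (dihedral n)) \<subseteq> ?E"
  proof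
    fix z assume "z \<in> derived_set (dihedral n) (carrier (dihedral n))"
    then obtain a s b t where z: "z = (a, s) \<otimes>\<^bsub>dihedral n\<^esub> (b, t) \<otimes>\<^bsub>dihedral n\<^esub> inv\<^bsub>dihedral n\<^esub> (a, s) \<otimes>\<^bsub>dihedral n\<^esub> inv\<^bsub>dihedral n\<^esub> (b, t)"
      and "(a, s) \<in> carrier (dihedral n)" "(b, t) \<in> carrier (dihedral n)" by auto
    then have "z = (2 * ((if t then a else 0) - (if s then b else 0)) mod int n, False)"
      using assms by (cases s; cases t) (simp_all add: inv_dihedral mod_simps, (simp_all add: algebra_simps)?)
    then show "z \<in> ?E" by blast
  qed
  ultimately show ?thesis unfolding derived_def by (rule generate_subgroup_incl[rotated])
qed

text \<open>
  The commutator of the rotation by \<open>a\<close> with a reflection is the rotation by \<open>2 * a\<close>.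
\<close>

lemma derived_dihedral:
  assumes "n > 0"
  shows "derived (dihedral n) (carrier (dihedral n)) = {(2 * a mod int n, False) | a. True}"
proof (rule antisym[OF derived_dihedral_subset[OF assms]], clarify)
  fix a :: int
  have "(2 * a mod int n, False) = (a mod int n, False) \<otimes>\<^bsub>dihedral n\<^esub> (0, True) \<otimes>\<^bsub>dihedral n\<^esub>
      inv\<^bsub>dihedral n\<^esub> (a mod int n, False) \<otimes>\<^bsub>dihedral n\<^esub> inv\<^bsub>dihedral n\<^esub> (0, True)"
    using assms by (simp add: inv_dihedral mod_simps)
  also have "\<dots> \<in> derived_set (dihedral n) (carrier (dihedral n))"
  proof -
    have "(a mod int n, False) \<in> carrier (dihedral n)" "(0, True) \<in> carrier (dihedral n)"
      using assms by simp_all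
    then show ?thesis by blast
  qed
  finally show "(2 * a mod int n, False) \<in> derived (dihedral n) (carrier (dihedral n))"
    unfolding derived_def by (rule generate.incl)
qed

text \<open>
  The dihedral group of order six: its derived subgroup consists of all three rotations, and every
  square is a rotation.
\<close>

lemma exists_nonabelian_in_Ab_exp_star:
  obtains G where "G \<in> Ab_exp 3 \<star> Ab_exp 2" "G \<notin> Ab"
proof -
  interpret D: group "dihedral 3" by (rule group_dihedral) simp
  obtain G :: "nat monoid" and h where G: "group G" "finite (carrier G)" "h \<in> iso (dihedral 3) G"
    using D.exists_nat_copy[OF finite_dihedral] by blast
  interpret h: group_hom "dihedral 3" G h
    using G D.is_group by (simp add: group_hom_def group_hom_axioms_def iso_def)
  have car: "carrier G = h ` carrier (dihedral 3)" and inj: "inj_on h (carrier (dihedral 3))"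
    using G(3) by (auto simp: iso_def bij_betw_def)
  have der: "derived G (carrier G) = h ` {(2 * a mod 3, False) | a. True}"
    unfolding car using h.derived_img[of "carrier (dihedral 3)"] by (simp add: derived_dihedral)
  have "G \<in> Ab_exp 3 \<star> Ab_exp 2"
    unfolding Ab_exp_star_iff
  proof (intro conjI exI[of _ "derived G (carrier G)"] ballI)
    show "derived G (carrier G) \<lhd> G" using h.H.derived_is_normal[OF h.H.normal_self] .
  next
    fix x y assume "x \<in> derived G (carrier G)" "y \<in> derived G (carrier G)"
    then obtain a b where "x = h (2 * a mod 3, False)" "y = h (2 * b mod 3, False)" unfolding der by blast
    then show "x \<otimes>\<^bsub>G\<^esub> y = y \<otimes>\<^bsub>G\<^esub> x" by (simp add: add.commute flip: h.hom_mult)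
  next
    fix x assume "x \<in> derived G (carrier G)"
    then obtain a where a: "x = h (2 * a mod 3, False)" unfolding der by blast
    have "h ((2 * a mod 3, False) [^]\<^bsub>dihedral 3\<^esub> (3::nat)) = h \<one>\<^bsub>dihedral 3\<^esub>"
      using rotation_pow[where a = "2 * a" and n = 3 and k = 3] by simp
    moreover have "(2 * a mod 3, False) \<in> carrier (dihedral 3)" by simp
    ultimately show "x [^]\<^bsub>G\<^esub> (3::nat) = \<one>\<^bsub>G\<^esub>"
      unfolding a by (simp only: h.hom_nat_pow h.hom_one)
  next
    fix g assume "g \<in> carrier G"
    then obtain a s where g: "g = h (a, s)" "(a, s) \<in> carrier (dihedral 3)" unfolding car by auto
    have "g [^]\<^bsub>G\<^esub> (2::nat) = h ((a, s) \<otimes>\<^bsub>dihedral 3\<^esub> (a, s))"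
      using g by (simp add: numeral_2_eq_2 del: mult_dihedral)
    moreover have "(a, s) \<otimes>\<^bsub>dihedral 3\<^esub> (a, s) = (2 * (if s then 0 else a) mod 3, False)" by simp
    ultimately show "g [^]\<^bsub>G\<^esub> (2::nat) \<in> derived G (carrier G)" unfolding der by blast
  qed (use G in auto)
  moreover have "G \<notin> Ab"
  proof
    assume "G \<in> Ab"
    then interpret G: comm_group G by (simp add: Ab_def)
    have "h ((1, False) \<otimes>\<^bsub>dihedral 3\<^esub> (0, True)) = h ((0, True) \<otimes>\<^bsub>dihedral 3\<^esub> (1, False))"
      using G.m_comm[of "h (1, False)" "h (0, True)"] by (simp add: car del: mult_dihedral)
    then have "(1::int, True) = (2, True)"
      using inj_onD[OF inj, of "(1, True)" "(2, True)"] by simp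
    then show False by simp
  qed
  ultimately show ?thesis using that by blast
qed

text \<open>
  The dihedral group of order eight: its derived subgroup has order two and is central.
\<close>

lemma exists_Su_Metab_not_odd_diagonalizable:
  obtains G where "G \<in> Su \<inter> Metab" "G \<notin> odd_diagonalizable"
proof -
  interpret D: group "dihedral 4" by (rule group_dihedral) simp
  obtain G :: "nat monoid" and h where G: "group G" "finite (carrier G)" "h \<in> iso (dihedral 4) G"
    using D.exists_nat_copy[OF finite_dihedral] by blast
  interpret h: group_hom "dihedral 4" G h
    using G D.is_group by (simp add: group_hom_def group_hom_axioms_def iso_def)
  have car: "carrier G = h ` carrier (dihedral 4)" and inj: "inj_on h (carrier (dihedral 4))"
    using G(3) by (auto simp: iso_def bij_betw_def)
  have der: "derived G (carrier G) = h ` {(2 * a mod 4, False) | a. True}"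
    unfolding car using h.derived_img[of "carrier (dihedral 4)"] by (simp add: derived_dihedral)
  have central: "g \<otimes>\<^bsub>G\<^esub> x = x \<otimes>\<^bsub>G\<^esub> g" if x: "x \<in> derived G (carrier G)" and g: "g \<in> carrier G" for x g
  proof -
    obtain a where a: "x = h (2 * a mod 4, False)" using x unfolding der by blast
    obtain b t where b: "g = h (b, t)" "(b, t) \<in> carrier (dihedral 4)" using g unfolding car by auto
    \<comment> \<open>Reflections invert rotations, and \<open>2 * a\<close> is its own inverse modulo \<open>4\<close>.\<close>
    have "(b - 2 * a) mod 4 = (b + 2 * a) mod 4"
      by (simp add: mod_eq_dvd_iff)
    then have "(b, t) \<otimes>\<^bsub>dihedral 4\<^esub> (2 * a mod 4, False) = (2 * a mod 4, False) \<otimes>\<^bsub>dihedral 4\<^esub> (b, t)"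
      by (cases t) (simp_all add: mod_simps add.commute)
    then show ?thesis using a b by (simp flip: h.hom_mult del: mult_dihedral)
  qed
  have "supersolvable G" using central by (rule h.H.supersolvable_if_derived_central)
  moreover have "derived G (carrier G) \<subseteq> carrier G" using h.H.derived_in_carrier by blast
  then have "comm_group (G\<lparr>carrier := derived G (carrier G)\<rparr>)"
    using central h.H.comm_group_subgroup_iff[OF h.H.derived_is_subgroup[of "carrier G"]] by blast
  ultimately have "G \<in> Su \<inter> Metab" using G by (simp add: Su_def Metab_def metabelian_def)
  moreover have "G \<notin> odd_diagonalizable"
  proof
    assume "G \<in> odd_diagonalizable"
    then obtain P where P: "finite P" "\<forall>p\<in>P. odd p" "diagonalizable_derived P G"
      unfolding odd_diagonalizable_def by blast
    define z where "z = h (2, False)"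
    have zc: "z \<in> carrier G" by (simp add: z_def)
    have "(2, False) = (2 * 1 mod 4 :: int, False)" by simp
    then have "z \<in> derived G (carrier G)" unfolding der z_def by blast
    then have "z [^]\<^bsub>G\<^esub> (\<Prod>P) = \<one>\<^bsub>G\<^esub>" using P(3) by (simp add: diagonalizable_derived_def)
    moreover have "odd (\<Prod>P)" using P by (simp add: even_prod_iff)
    then obtain k where "\<Prod>P = 2 * k + 1" by (rule oddE)
    moreover have "z [^]\<^bsub>G\<^esub> (2 * k + 1) = (z \<otimes>\<^bsub>G\<^esub> z) [^]\<^bsub>G\<^esub> k \<otimes>\<^bsub>G\<^esub> z"
    proof -
      have "z [^]\<^bsub>G\<^esub> (2 * k + 1) = (z [^]\<^bsub>G\<^esub> (2::nat)) [^]\<^bsub>G\<^esub> k \<otimes>\<^bsub>G\<^esub> z"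
        using h.H.nat_pow_pow[OF zc, of 2 k] by simp
      also have "z [^]\<^bsub>G\<^esub> (2::nat) = z \<otimes>\<^bsub>G\<^esub> z" using zc by (simp add: numeral_2_eq_2)
      finally show ?thesis .
    qed
    moreover have "z \<otimes>\<^bsub>G\<^esub> z = \<one>\<^bsub>G\<^esub>"
    proof -
      have "z \<otimes>\<^bsub>G\<^esub> z = h ((2, False) \<otimes>\<^bsub>dihedral 4\<^esub> (2, False))"
        unfolding z_def by (subst h.hom_mult) simp_all
      also have "(2, False) \<otimes>\<^bsub>dihedral 4\<^esub> (2, False) = \<one>\<^bsub>dihedral 4\<^esub>" by simp
      finally show ?thesis by (simp only: h.hom_one)
    qed
    ultimately have "z = \<one>\<^bsub>G\<^esub>" using zc by simp
    then have "h (2, False) = h (0, False)" using h.hom_one by (simp add: z_def)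
    then show False using inj_onD[OF inj, of "(2, False)" "(0, False)"] by simp
  qed
  ultimately show ?thesis using that by blast
qed

section \<open>The two proper inclusions\<close>

theorem proposition5p4:
  fixes U :: "nat monoid set"
  assumes "U = pv_join {Ab_exp p \<star> Ab_exp (p - 1) | p. Factorial_Ring.prime p}"
  shows "Ab \<subset> U \<and> U \<subset> Su \<inter> Metab"
proof -
  let ?V = "{Ab_exp p \<star> Ab_exp (p - 1) | p. Factorial_Ring.prime p}"
  have "Ab \<subseteq> W" if "pseudovariety W" "\<forall>V\<in>?V. V \<subseteq> W" for W
  proof (rule Ab_subset_pseudovariety[OF that(1)])
    fix p :: nat assume "Factorial_Ring.prime p"
    then have "Ab_exp p \<star> Ab_exp (p - 1) \<subseteq> W" using that(2) by blast
    then show "Ab_exp (p - 1) \<subseteq> W" using Ab_exp_subset_star by blast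
  qed
  then have "Ab \<subseteq> U" unfolding assms pv_join_def by blast
  moreover obtain G where "G \<in> Ab_exp 3 \<star> Ab_exp 2" "G \<notin> Ab"
    using exists_nonabelian_in_Ab_exp_star .
  moreover have "Ab_exp 3 \<star> Ab_exp 2 \<subseteq> U"
  proof -
    have "Ab_exp 3 \<star> Ab_exp (3 - 1) \<in> ?V" using prime_nat_numeral_eq by (intro CollectI exI[of _ 3]) simp
    from pv_join_superset[OF this] show ?thesis unfolding assms by simp
  qed
  moreover have "U \<subseteq> odd_diagonalizable"
    unfolding assms
  proof (rule pv_join_least[OF pseudovariety_odd_diagonalizable])
    fix V assume "V \<in> ?V"
    then show "V \<subseteq> odd_diagonalizable" using Ab_exp_star_subset_odd_diagonalizable by blast
  qed
  moreover obtain H where "H \<in> Su \<inter> Metab" "H \<notin> odd_diagonalizable"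
    using exists_Su_Metab_not_odd_diagonalizable .
  ultimately show ?thesis using odd_diagonalizable_subset_Su_Metab by blast
qed

end
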